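(* Let $E$ be a Lie conformal algebroid over the differential algebra $A$ and let $M$ be a module over $E$. For $k\ge0$ and $\widetilde\varphi\in\widetilde C^k(E,M)$ the formula (in $M[\lambda_1,\dots,\lambda_{k+1}]$) $$(\widetilde d\widetilde\varphi)_{\lambda_1,\dots,\lambda_{k+1}}(u_1,\dots,u_{k+1})=\sum_{i=1}^{k+1}(-1)^{i+1}{u_i}_{\lambda_i}\Big(\widetilde\varphi_{\lambda_1,\overset{i}{\check\dots},\lambda_{k+1}}(u_1,\overset{i}{\check\dots},u_{k+1})\Big)+\sum_{1\le i<j\le k+1}(-1)^{i+j}\widetilde\varphi_{\lambda_i+\lambda_j,\lambda_1,\overset{i}{\check\dots}\overset{j}{\check\dots},\lambda_{k+1}}\big([{u_i}_{\lambda_i}u_j],u_1,\overset{i}{\check\dots}\overset{j}{\check\dots},u_{k+1}\big)$$ provides a well defined linear map $\widetilde d:\widetilde C^k(E,M)\to\widetilde C^{k+1}(E,M)$, and $\widetilde d\circ\widetilde d=0$.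
   Context: Everything is over a field $\mathbb F$ of characteristic $0$. A differential algebra $A$ is a commutative associative unital algebra with a derivation $\partial$; $A[\partial]$ is the associative algebra of differential operators $a(\partial)=\sum_i a_i\partial^i$ (product = composition), with symbol $a(x)=\sum_ia_ix^i$ and adjoint symbol $a^*(\lambda)=\sum_i(-\lambda-\partial)^i(a_i)\in A[\lambda]$. Substitution convention: in an expression containing a factor $\big(\big|_{x=\partial}f\big)$, expand the whole expression in powers of the commuting indeterminate $x$ and replace each $x^n$ by $\partial^n$ acting only on what is inside that parenthesis (on coefficients, if $f$ is a polynomial). E.g. $a(\lambda+x)\big(\big|_{x=\partial}b\big)c=c\sum_ia_i(\lambda+\partial)^i(b)$. For $\theta_\lambda$ linear, $\theta_\lambda(a(x))=\sum_i\theta_\lambda(a_i)x^i$. $\mathrm{CDer}(A)$ is the space of linear maps $\phi_\lambda:A\to A[\lambda]$ with $\phi_\lambda(\partial a)=(\partial+\lambda)\phi_\lambda(a)$ and $\phi_\lambda(ab)=\phi_\lambda(a)b+a\phi_\lambda(b)$; it is a left $A[\partial]$-module by $(a(\partial)\phi)_\lambda=\big(\big|_{x=\partial}a^*(\lambda)\big)\phi_{\lambda+x}$. A Lie conformal algebra (LCA) is an $\mathbb F[\partial]$-module $E$ with a bilinear $\lambda$-bracket $[\cdot_\lambda\cdot]:E\otimes E\to E[\lambda]$ with: $[\partial u_\lambda v]=-\lambda[u_\lambda v]$, $[u_\lambda\partial v]=(\partial+\lambda)[u_\lambda v]$; $[v_\lambda u]=-\big(\big|_{x=\partial}[u_{-\lambda-x}v]\big)$;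 $[u_\lambda[v_\mu w]]-[v_\mu[u_\lambda w]]=[[u_\lambda v]_{\lambda+\mu}w]$. A Lie conformal algebroid (LCAd) over $A$ is a left $A[\partial]$-module $E$ with a left $A[\partial]$-module homomorphism $\theta:E\to\mathrm{CDer}(A)$ (anchor) and an LCA $\lambda$-bracket such that (i) $[u_\lambda a(\partial)v]=a(\lambda+x)\big(\big|_{x=\partial}[u_\lambda v]\big)+\theta(u)_\lambda(a(x))\big(\big|_{x=\partial}v\big)$, and (ii) $\theta([u_\lambda v])_\mu(a)=\theta(u)_\lambda(\theta(v)_{\mu-\lambda}(a))-\theta(v)_{\mu-\lambda}(\theta(u)_\lambda(a))$. A module over the LCAd $E$ is a left $A[\partial]$-module $M$ with a bilinear $\lambda$-action $E\times M\to M[\lambda]$, $(u,m)\mapsto u_\lambda m$, such that (i) $u_\lambda(a(\partial)m)=a(\lambda+x)\big(\big|_{x=\partial}u_\lambda m\big)+\theta(u)_\lambda(a(x))\big(\big|_{x=\partial}m\big)$; (ii) $(a(\partial)u)_\lambda m=\big(\big|_{x=\partial}a^*(\lambda)\big)(u_{\lambda+x}m)$; (iii) $[u_\lambda v]_\mu m=u_\lambda(v_{\mu-\lambda}m)-v_{\mu-\lambda}(u_\lambda m)$. The space of basic $k$-cochains $\widetilde C^k(E,M)$, $k\ge0$, is the space of linear maps $\widetilde\varphi_{\lambda_1,\dots,\lambda_k}:E^{\otimes k}\to M[\lambda_1,\dots,\lambda_k]$ (so $\widetilde C^0(E,M)=M$) such that, in $M[\lambda_1,\dots,\lambda_k]$,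 $\widetilde\varphi_{\lambda_1,\dots,\lambda_k}(a_1(\partial)u_1,\dots,a_k(\partial)u_k)=\big(\big|_{x_1=\partial}a_1^*(\lambda_1)\big)\cdots\big(\big|_{x_k=\partial}a_k^*(\lambda_k)\big)\widetilde\varphi_{\lambda_1+x_1,\dots,\lambda_k+x_k}(u_1,\dots,u_k)$ for $a_i(\partial)\in A[\partial]$, and $\widetilde\varphi_{\lambda_1,\dots,\lambda_k}(u_1,\dots,u_k)=\mathrm{sign}(\pi)\,\widetilde\varphi_{\lambda_{\pi(1)},\dots,\lambda_{\pi(k)}}(u_{\pi(1)},\dots,u_{\pi(k)})$ for all $\pi\in S_k$. $\overset{i}{\check\dots}$ means that the $i$-th entry is omitted; ${u_i}_{\lambda_i}$ and $\widetilde\varphi$ are extended linearly over polynomials in the $\lambda$'s. *)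

theory Defs
  imports
    "HOL-Library.Poly_Mapping"
    "HOL-Computational_Algebra.Polynomial"
    "HOL-Combinatorics.Permutations"
begin

section \<open>Polynomials with coefficients in a module\<close>

text \<open>
  Polynomial expressions over a space V live in one type \<open>'v mpol\<close>, with commuting
  indeterminates \<open>Lam i\<close> (the i-th lambda, counted from 0) and \<open>X i\<close> (the auxiliary x's of the
  substitution convention).  A \<open>\<lambda>\<close>-bracket or \<open>\<lambda>\<close>-action is a map into V[lambda] with
  lambda = \<open>Lam 0\<close>; other values of lambda are obtained by \<open>at_poly\<close> below.
\<close>

datatype var = Lam nat | X nat

type_synonym 'v mpol = "(var \<Rightarrow>\<^sub>0 nat) \<Rightarrow>\<^sub>0 'v"

definition pvar :: "var \<Rightarrow> 'k::comm_ring_1 mpol"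
  where "pvar v = Poly_Mapping.single (Poly_Mapping.single v 1) 1"

abbreviation \<Lambda> :: "nat \<Rightarrow> 'k::comm_ring_1 mpol"
  where "\<Lambda> i \<equiv> pvar (Lam i)"

abbreviation \<xi> :: "nat \<Rightarrow> 'k::comm_ring_1 mpol"
  where "\<xi> i \<equiv> pvar (X i)"

text \<open>The subspace V[lambda_0, ..., lambda_(k-1)].\<close>

definition lam_polys :: "nat \<Rightarrow> 'v::zero mpol set"
  where "lam_polys k = {F. \<forall>m \<in> Poly_Mapping.keys F. Poly_Mapping.keys m \<subseteq> Lam ` {..<k}}"

definition coeff_scale :: "('k \<Rightarrow> 'v \<Rightarrow> 'v) \<Rightarrow> 'k \<Rightarrow> 'v mpol \<Rightarrow> 'v::zero mpol"
  where "coeff_scale s c = Poly_Mapping.map (s c)"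

definition monom_mult :: "(var \<Rightarrow>\<^sub>0 nat) \<Rightarrow> 'v mpol \<Rightarrow> 'v::comm_monoid_add mpol"
  where "monom_mult m F =
    (\<Sum>n \<in> Poly_Mapping.keys F. Poly_Mapping.single (m + n) (Poly_Mapping.lookup F n))"

definition var_mult :: "var \<Rightarrow> 'v mpol \<Rightarrow> 'v::comm_monoid_add mpol"
  where "var_mult v = monom_mult (Poly_Mapping.single v 1)"

text \<open>For a scalar polynomial q and a vector v, the polynomial q v with coefficients in V.\<close>

definition poly_times_vec :: "('k \<Rightarrow> 'v \<Rightarrow> 'v) \<Rightarrow> 'k::zero mpol \<Rightarrow> 'v \<Rightarrow> 'v::zero mpol"
  where "poly_times_vec s q v = Poly_Mapping.map (\<lambda>c. s c v) q"

text \<open>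
  Substitution of the scalar polynomials \<open>qs ! 0, qs ! 1, ...\<close> for \<open>Lam 0, Lam 1, ...\<close> in an
  element of \<open>lam_polys (length qs)\<close>; \<open>s\<close> is the scalar multiplication of V.
\<close>

definition at_poly ::
  "('k \<Rightarrow> 'v \<Rightarrow> 'v) \<Rightarrow> 'k::comm_ring_1 mpol list \<Rightarrow> 'v mpol \<Rightarrow> 'v::comm_monoid_add mpol"
  where "at_poly s qs F =
    (\<Sum>m \<in> Poly_Mapping.keys F.
       poly_times_vec s (\<Prod>i<length qs. (qs ! i) ^ Poly_Mapping.lookup m (Lam i))
         (Poly_Mapping.lookup F m))"

text \<open>
  Extension of a map f (from V to W[lambda, x]) to polynomials with coefficients in V,
  linearly over the indeterminates.
\<close>

definition lin_ext ::
  "('v \<Rightarrow> 'w mpol) \<Rightarrow> 'v::zero mpol \<Rightarrow> 'w::comm_monoid_add mpol"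
  where "lin_ext f F =
    (\<Sum>m \<in> Poly_Mapping.keys F. monom_mult m (f (Poly_Mapping.lookup F m)))"

text \<open>
  The substitution convention.  \<open>subst_inside x D F\<close> is the case where x occurs only inside the
  parenthesis: every x^n is replaced by D^n acting on the coefficients of F.
  \<open>subst_factor b x D Q f\<close> is the value of Q(x) (|_(x=D) f) for Q in V[lambda, x] and f free of
  x: Q is expanded in powers of x, and x^n is replaced by D^n acting on the coefficients of f
  only; \<open>b\<close> is the product of a coefficient of Q with a coefficient of f.
\<close>

definition subst_inside :: "var \<Rightarrow> ('v \<Rightarrow> 'v) \<Rightarrow> 'v mpol \<Rightarrow> 'v::comm_monoid_add mpol"
  where "subst_inside x D F =
    (\<Sum>m \<in> Poly_Mapping.keys F.
       Poly_Mapping.single (Poly_Mapping.update x 0 m)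
         ((D ^^ Poly_Mapping.lookup m x) (Poly_Mapping.lookup F m)))"

definition subst_factor ::
  "('q \<Rightarrow> 'f \<Rightarrow> 'w) \<Rightarrow> var \<Rightarrow> ('f \<Rightarrow> 'f) \<Rightarrow> 'q::zero mpol \<Rightarrow> 'f::zero mpol \<Rightarrow>
     'w::comm_monoid_add mpol"
  where "subst_factor b x D Q f =
    (\<Sum>m \<in> Poly_Mapping.keys Q. \<Sum>n \<in> Poly_Mapping.keys f.
       Poly_Mapping.single (Poly_Mapping.update x 0 m + n)
         (b (Poly_Mapping.lookup Q m)
            ((D ^^ Poly_Mapping.lookup m x) (Poly_Mapping.lookup f n))))"


section \<open>Differential algebras and differential operators\<close>

locale differential_algebra = vector_space sA
  for sA :: "'k::field_char_0 \<Rightarrow> 'a::comm_ring_1 \<Rightarrow> 'a" +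
  fixes der :: "'a \<Rightarrow> 'a"
  assumes scale_mult: "sA c (a * b) = sA c a * b"
    and der_linear: "Vector_Spaces.linear sA sA der"
    and der_mult: "der (a * b) = der a * b + a * der b"

text \<open>
  A differential operator is represented by its symbol, an element of \<open>'a poly\<close> (whose own
  product is not the one of differential operators).  Composition from the left with the
  derivation sends Q to \<open>Q x + der Q\<close>.
\<close>

definition der_compose :: "('a \<Rightarrow> 'a) \<Rightarrow> 'a poly \<Rightarrow> 'a::comm_ring_1 poly"
  where "der_compose der Q = pCons 0 Q + map_poly der Q"

definition diffop_mult :: "('a \<Rightarrow> 'a) \<Rightarrow> 'a poly \<Rightarrow> 'a poly \<Rightarrow> 'a::comm_ring_1 poly"
  where "diffop_mult der P Q =
    (\<Sum>i\<le>degree P. smult (coeff P i) ((der_compose der ^^ i) Q))"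

definition symbol :: "('k \<Rightarrow> 'a \<Rightarrow> 'a) \<Rightarrow> 'a poly \<Rightarrow> 'k::comm_ring_1 mpol \<Rightarrow> 'a::comm_ring_1 mpol"
  where "symbol sA P q = (\<Sum>i\<le>degree P. poly_times_vec sA (q ^ i) (coeff P i))"

definition adjoint_symbol :: "('a \<Rightarrow> 'a) \<Rightarrow> 'a poly \<Rightarrow> nat \<Rightarrow> 'a::comm_ring_1 mpol"
  where "adjoint_symbol der P j =
    (\<Sum>i\<le>degree P.
       ((\<lambda>F. - var_mult (Lam j) F - Poly_Mapping.map der F) ^^ i)
         (Poly_Mapping.single 0 (coeff P i)))"

text \<open>(|_(x_j=D) P^*(lambda_j)) F for F depending on lambda and x_j; \<open>sm\<close> is the action of A on the
  coefficients of F.\<close>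

definition adjoint_apply ::
  "('a \<Rightarrow> 'a) \<Rightarrow> ('a \<Rightarrow> 'v \<Rightarrow> 'v) \<Rightarrow> nat \<Rightarrow> 'a::comm_ring_1 poly \<Rightarrow> 'v mpol \<Rightarrow>
     'v::comm_monoid_add mpol"
  where "adjoint_apply der sm j P F =
    subst_factor (\<lambda>v a. sm a v) (X j) der F (adjoint_symbol der P j)"

text \<open>
  A left module over the algebra of differential operators; the action of A, the derivation and
  the scalar multiplication by the ground field are restrictions of its action.  \<open>const_act\<close>
  and \<open>der_act\<close> are also used for modules over F[D], with A replaced by the ground field.
\<close>

locale diffop_module = differential_algebra sA der
  for sA :: "'k::field_char_0 \<Rightarrow> 'a::comm_ring_1 \<Rightarrow> 'a" and der +
  fixes act :: "'a poly \<Rightarrow> 'v::ab_group_add \<Rightarrow> 'v"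
  assumes act_add_left: "act (P + Q) v = act P v + act Q v"
    and act_add_right: "act P (v + w) = act P v + act P w"
    and act_mult: "act (diffop_mult der P Q) v = act P (act Q v)"
    and act_one: "act 1 v = v"

definition const_act :: "('a poly \<Rightarrow> 'v \<Rightarrow> 'v) \<Rightarrow> 'a::comm_ring_1 \<Rightarrow> 'v \<Rightarrow> 'v"
  where "const_act act a = act [:a:]"

definition der_act :: "('a::comm_ring_1 poly \<Rightarrow> 'v \<Rightarrow> 'v) \<Rightarrow> 'v \<Rightarrow> 'v"
  where "der_act act = act [:0, 1:]"

definition scalar_act ::
  "('k \<Rightarrow> 'a \<Rightarrow> 'a) \<Rightarrow> ('a::comm_ring_1 poly \<Rightarrow> 'v \<Rightarrow> 'v) \<Rightarrow> 'k \<Rightarrow> 'v \<Rightarrow> 'v"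
  where "scalar_act sA act c = act [:sA c 1:]"


section \<open>Conformal derivations\<close>

definition CDer :: "('k::field_char_0 \<Rightarrow> 'a \<Rightarrow> 'a) \<Rightarrow> ('a \<Rightarrow> 'a) \<Rightarrow> ('a \<Rightarrow> 'a::comm_ring_1 mpol) set"
  where "CDer sA der = {\<phi>.
    Vector_Spaces.linear sA (coeff_scale sA) \<phi> \<and>
    (\<forall>a. \<phi> a \<in> lam_polys 1) \<and>
    (\<forall>a. \<phi> (der a) = Poly_Mapping.map der (\<phi> a) + var_mult (Lam 0) (\<phi> a)) \<and>
    (\<forall>a b. \<phi> (a * b) = \<phi> a * Poly_Mapping.single 0 b + Poly_Mapping.single 0 a * \<phi> b)}"

definition CDer_act ::
  "('k::field_char_0 \<Rightarrow> 'a \<Rightarrow> 'a) \<Rightarrow> ('a \<Rightarrow> 'a) \<Rightarrow> 'a poly \<Rightarrow> ('a \<Rightarrow> 'a mpol) \<Rightarrow>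
     'a \<Rightarrow> 'a::comm_ring_1 mpol"
  where "CDer_act sA der P \<phi> b =
    adjoint_apply der (*) 0 P (at_poly sA [\<Lambda> 0 + \<xi> 0] (\<phi> b))"


section \<open>Lie conformal algebras and algebroids\<close>

locale lie_conformal_algebra = module act
  for act :: "'k::field_char_0 poly \<Rightarrow> 'e::ab_group_add \<Rightarrow> 'e" +
  fixes br :: "'e \<Rightarrow> 'e \<Rightarrow> 'e mpol"
  assumes br_linear_left:
      "Vector_Spaces.linear (const_act act) (coeff_scale (const_act act)) (\<lambda>u. br u v)"
    and br_linear_right:
      "Vector_Spaces.linear (const_act act) (coeff_scale (const_act act)) (br u)"
    and br_poly: "br u v \<in> lam_polys 1"
    and br_der_left: "br (der_act act u) v = - var_mult (Lam 0) (br u v)"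
    and br_der_right:
      "br u (der_act act v) =
         Poly_Mapping.map (der_act act) (br u v) + var_mult (Lam 0) (br u v)"
    and br_skew:
      "br v u =
         - subst_inside (X 0) (der_act act) (at_poly (const_act act) [- \<Lambda> 0 - \<xi> 0] (br u v))"
    and br_jacobi:
      "lin_ext (\<lambda>z. at_poly (const_act act) [\<Lambda> 0] (br u z)) (at_poly (const_act act) [\<Lambda> 1] (br v w))
       - lin_ext (\<lambda>z. at_poly (const_act act) [\<Lambda> 1] (br v z)) (at_poly (const_act act) [\<Lambda> 0] (br u w))
       = lin_ext (\<lambda>z. at_poly (const_act act) [\<Lambda> 0 + \<Lambda> 1] (br z w))
           (at_poly (const_act act) [\<Lambda> 0] (br u v))"

locale lie_conformal_algebroid =
  E: diffop_module sA der actE +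
  L: lie_conformal_algebra "\<lambda>p. actE (map_poly (\<lambda>c. sA c 1) p)" br
  for sA :: "'k::field_char_0 \<Rightarrow> 'a::comm_ring_1 \<Rightarrow> 'a" and der :: "'a \<Rightarrow> 'a"
    and actE :: "'a poly \<Rightarrow> 'e::ab_group_add \<Rightarrow> 'e" and br :: "'e \<Rightarrow> 'e \<Rightarrow> 'e mpol" +
  fixes \<theta> :: "'e \<Rightarrow> 'a \<Rightarrow> 'a mpol"
  assumes anchor_CDer: "\<theta> u \<in> CDer sA der"
    and anchor_add: "\<theta> (u + v) = (\<lambda>a. \<theta> u a + \<theta> v a)"
    and anchor_act: "\<theta> (actE P u) = CDer_act sA der P (\<theta> u)"
    and br_act_right:
      "br u (actE P v) =
         subst_factor (const_act actE) (X 0) (der_act actE) (symbol sA P (\<Lambda> 0 + \<xi> 0)) (br u v)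
         + subst_factor (const_act actE) (X 0) (der_act actE)
             (lin_ext (\<theta> u) (symbol sA P (\<xi> 0))) (Poly_Mapping.single 0 v)"
    and anchor_br:
      "lin_ext (\<lambda>z. at_poly sA [\<Lambda> 1] (\<theta> z a)) (at_poly (scalar_act sA actE) [\<Lambda> 0] (br u v))
       = lin_ext (\<lambda>b. at_poly sA [\<Lambda> 0] (\<theta> u b)) (at_poly sA [\<Lambda> 1 - \<Lambda> 0] (\<theta> v a))
         - lin_ext (\<lambda>b. at_poly sA [\<Lambda> 1 - \<Lambda> 0] (\<theta> v b)) (at_poly sA [\<Lambda> 0] (\<theta> u a))"

locale lie_conformal_algebroid_module =
  lie_conformal_algebroid sA der actE br \<theta> +
  M: diffop_module sA der actM
  for sA :: "'k::field_char_0 \<Rightarrow> 'a::comm_ring_1 \<Rightarrow> 'a" and der :: "'a \<Rightarrow> 'a"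
    and actE :: "'a poly \<Rightarrow> 'e::ab_group_add \<Rightarrow> 'e" and br :: "'e \<Rightarrow> 'e \<Rightarrow> 'e mpol"
    and \<theta> :: "'e \<Rightarrow> 'a \<Rightarrow> 'a mpol"
    and actM :: "'a poly \<Rightarrow> 'm::ab_group_add \<Rightarrow> 'm" +
  fixes lact :: "'e \<Rightarrow> 'm \<Rightarrow> 'm mpol"
  assumes lact_linear_left:
      "Vector_Spaces.linear (scalar_act sA actE) (coeff_scale (scalar_act sA actM)) (\<lambda>u. lact u m)"
    and lact_linear_right:
      "Vector_Spaces.linear (scalar_act sA actM) (coeff_scale (scalar_act sA actM)) (lact u)"
    and lact_poly: "lact u m \<in> lam_polys 1"
    and lact_act_right:
      "lact u (actM P m) =
         subst_factor (const_act actM) (X 0) (der_act actM) (symbol sA P (\<Lambda> 0 + \<xi> 0)) (lact u m)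
         + subst_factor (const_act actM) (X 0) (der_act actM)
             (lin_ext (\<theta> u) (symbol sA P (\<xi> 0))) (Poly_Mapping.single 0 m)"
    and lact_act_left:
      "lact (actE P u) m =
         adjoint_apply der (const_act actM) 0 P
           (at_poly (scalar_act sA actM) [\<Lambda> 0 + \<xi> 0] (lact u m))"
    and lact_br:
      "lin_ext (\<lambda>z. at_poly (scalar_act sA actM) [\<Lambda> 1] (lact z m))
         (at_poly (scalar_act sA actE) [\<Lambda> 0] (br u v))
       = lin_ext (\<lambda>n. at_poly (scalar_act sA actM) [\<Lambda> 0] (lact u n))
           (at_poly (scalar_act sA actM) [\<Lambda> 1 - \<Lambda> 0] (lact v m))
         - lin_ext (\<lambda>n. at_poly (scalar_act sA actM) [\<Lambda> 1 - \<Lambda> 0] (lact v n))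
             (at_poly (scalar_act sA actM) [\<Lambda> 0] (lact u m))"


section \<open>Basic cochains and the differential\<close>

text \<open>
  A k-cochain is a function on lists, multilinear on the lists of length k; its value on
  \<open>us\<close> is the polynomial in \<open>Lam 0, ..., Lam (k - 1)\<close>.  It is fixed to be 0 on lists of any other
  length, so that equality of cochains is equality of functions.  In the sesquilinearity axiom
  \<open>foldr\<close> forms the product over i of the factors (|_(x_i=D) P_i^*(lambda_i)).
\<close>

definition basic_cochains ::
  "('k::field_char_0 \<Rightarrow> 'a \<Rightarrow> 'a) \<Rightarrow> ('a \<Rightarrow> 'a) \<Rightarrow> ('a::comm_ring_1 poly \<Rightarrow> 'e::ab_group_add \<Rightarrow> 'e) \<Rightarrow>
     ('a poly \<Rightarrow> 'm::ab_group_add \<Rightarrow> 'm) \<Rightarrow> nat \<Rightarrow> ('e list \<Rightarrow> 'm mpol) set"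
  where "basic_cochains sA der actE actM k = {\<phi>.
    (\<forall>us. length us \<noteq> k \<longrightarrow> \<phi> us = 0) \<and>
    (\<forall>us. length us = k \<longrightarrow> \<phi> us \<in> lam_polys k) \<and>
    (\<forall>us. \<forall>i<k. length us = k \<longrightarrow>
       Vector_Spaces.linear (scalar_act sA actE) (coeff_scale (scalar_act sA actM))
         (\<lambda>u. \<phi> (us[i := u]))) \<and>
    (\<forall>Ps us. length Ps = k \<longrightarrow> length us = k \<longrightarrow>
       \<phi> (map2 actE Ps us) =
         foldr (\<lambda>i. adjoint_apply der (const_act actM) i (Ps ! i)) [0..<k]
           (at_poly (scalar_act sA actM) (map (\<lambda>i. \<Lambda> i + \<xi> i) [0..<k]) (\<phi> us))) \<and>
    (\<forall>\<pi> us. \<pi> permutes {..<k} \<longrightarrow> length us = k \<longrightarrow>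
       \<phi> us = coeff_scale (scalar_act sA actM) (of_int (sign \<pi>))
         (at_poly (scalar_act sA actM) (map (\<lambda>i. \<Lambda> (\<pi> i)) [0..<k]) (\<phi> (permute_list \<pi> us))))}"

text \<open>
  Arguments are indexed from 0: the sign (-1)^(i+1) of the first sum becomes (-1)^i, and the
  sign (-1)^(i+j) of the second is unaffected.
\<close>

definition basic_differential ::
  "('k::field_char_0 \<Rightarrow> 'a \<Rightarrow> 'a) \<Rightarrow> ('a::comm_ring_1 poly \<Rightarrow> 'e::ab_group_add \<Rightarrow> 'e) \<Rightarrow>
     ('e \<Rightarrow> 'e \<Rightarrow> 'e mpol) \<Rightarrow> ('a poly \<Rightarrow> 'm::ab_group_add \<Rightarrow> 'm) \<Rightarrow>
     ('e \<Rightarrow> 'm \<Rightarrow> 'm mpol) \<Rightarrow> nat \<Rightarrow> ('e list \<Rightarrow> 'm mpol) \<Rightarrow> 'e list \<Rightarrow> 'm mpol"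
  where "basic_differential sA actE br actM lact k \<phi> us =
    (let sE = scalar_act sA actE; sM = scalar_act sA actM; ls = map \<Lambda> [0..<Suc k] in
     if length us = Suc k then
       (\<Sum>i<Suc k. coeff_scale sM ((-1) ^ i)
          (lin_ext (\<lambda>m. at_poly sM [\<Lambda> i] (lact (us ! i) m))
             (at_poly sM (nths ls (- {i})) (\<phi> (nths us (- {i}))))))
       + (\<Sum>j<Suc k. \<Sum>i<j. coeff_scale sM ((-1) ^ (i + j))
          (lin_ext
             (\<lambda>z. at_poly sM ((\<Lambda> i + \<Lambda> j) # nths ls (- {i, j})) (\<phi> (z # nths us (- {i, j}))))
             (at_poly sE [\<Lambda> i] (br (us ! i) (us ! j)))))
     else 0)"

end

(* Evaluated at scalars l, the lambda-bracket and the lambda-action become operations on pairs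
   (u, l) with [(u, l), (v, m)] = ([u_l v], l + m), for which the Jacobi identity holds exactly and
   skew-symmetry holds modulo (D + l)(E).  Since the ground field is infinite, a polynomial is
   determined by its values, so a basic cochain is the same as an alternating map on pairs that is
   sesquilinear and polynomial in each slot, and the differential becomes the Chevalley-Eilenberg
   differential of a Leibniz algebra of pairs acting on M.  Its square vanishes by Cartan's formula.
   Sesquilinearity over A of the differential in a slot x needs a pairing of terms: neither
   y . phi(x, ...) nor phi([y, x], ...) is sesquilinear in x, but in their difference the two
   contributions of the anchor cancel. *)
theory Submission
  imports Defs
begin

text \<open>The obstacle is the substitution convention: the auxiliary \<open>x\<close> stands for a
  derivation acting on coefficients, so it cannot simply be given a scalar value. An expression is
  therefore evaluated at scalars in all indeterminates except \<open>x\<close>, which leaves a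
  polynomial function of a scalar \<open>t\<close>; then \<open>t ^ n\<close> is replaced by the
  n-th power of the derivation. This is legitimate because coefficients can be recovered from
  values, and it lets a derivation on one factor be traded for multiplication by \<open>t\<close> on
  the other. Pairs with different second components have no sum, so the Jacobi identity and the
  skew-symmetry of the bracket are demanded only of its image under a cochain. Functions are taken
  on lists of every length: fixing the first argument then gives a function of the same kind, and
  the identities go by induction on the list. The explicit alternating sum serves to compare with
  the given formula and to read off the dependence on the first argument; skew-symmetry carries that
  slot to all others.\<close>

section \<open>Sums over the terms of a polynomial\<close>

definition term_sum :: "('i \<Rightarrow> 'v \<Rightarrow> 'w) \<Rightarrow> ('i \<Rightarrow>\<^sub>0 'v::zero) \<Rightarrow> 'w::comm_monoid_add"
  where "term_sum h F = (\<Sum>m \<in> Poly_Mapping.keys F. h m (Poly_Mapping.lookup F m))"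

text \<open>This condition makes \<open>term_sum\<close> additive even where the keys of the two
  summands overlap or cancel.\<close>

definition additive_terms :: "('i \<Rightarrow> 'v::ab_group_add \<Rightarrow> 'w::ab_group_add) \<Rightarrow> bool"
  where "additive_terms h \<longleftrightarrow> (\<forall>m x y. h m (x + y) = h m x + h m y)"

lemma additive_zero:
  fixes f :: "'v::ab_group_add \<Rightarrow> 'w::ab_group_add"
  assumes "\<And>x y. f (x + y) = f x + f y"
  shows "f 0 = 0"
  using assms[of 0 0] by simp

lemma additive_uminus:
  fixes f :: "'v::ab_group_add \<Rightarrow> 'w::ab_group_add"
  assumes "\<And>x y. f (x + y) = f x + f y"
  shows "f (- x) = - f x"
proof -
  have "f (- x) + f x = 0"
    using assms[of "- x" x] additive_zero[of f] assms by simp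
  then show ?thesis
    by (simp add: eq_neg_iff_add_eq_0)
qed

lemma additive_sum:
  fixes f :: "'v::ab_group_add \<Rightarrow> 'w::ab_group_add"
  assumes "\<And>x y. f (x + y) = f x + f y"
  shows "f (sum g S) = (\<Sum>i\<in>S. f (g i))"
  by (induction S rule: infinite_finite_induct) (simp_all add: assms additive_zero)

lemma additive_termsD:
  assumes "additive_terms h"
  shows "h m (x + y) = h m x + h m y" "h m 0 = 0"
  using assms additive_zero[of "h m"] by (auto simp: additive_terms_def)

lemma term_sum_zero [simp]: "term_sum h 0 = 0"
  by (simp add: term_sum_def)

lemma term_sum_single: "h m 0 = 0 \<Longrightarrow> term_sum h (Poly_Mapping.single m v) = h m v"
  by (simp add: term_sum_def)

lemma term_sum_add:
  assumes "additive_terms h"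
  shows "term_sum h (F + G) = term_sum h F + term_sum h G"
  unfolding term_sum_def
  by (rule setsum_keys_plus_distrib) (use assms in \<open>auto simp: additive_termsD\<close>)

lemma poly_mapping_terms_induct [case_names single add]:
  fixes F :: "'i \<Rightarrow>\<^sub>0 'v::comm_monoid_add"
  assumes "\<And>m v. P (Poly_Mapping.single m v)"
    and "\<And>F G. P F \<Longrightarrow> P G \<Longrightarrow> P (F + G)"
  shows "P F"
proof (induction F rule: update_induct)
  case const
  show ?case
    using assms(1)[of undefined 0] by simp
next
  case (update F m v)
  have "Poly_Mapping.update m v F = F + Poly_Mapping.single m v"
    using update(1) by (intro poly_mapping_eqI)
      (auto simp: lookup_update lookup_add lookup_single in_keys_iff)
  then show ?case
    using assms update by simp
qed

lemma additive_eqI: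
  fixes f g :: "('i \<Rightarrow>\<^sub>0 'v::comm_monoid_add) \<Rightarrow> 'w::ab_semigroup_add"
  assumes "\<And>F G. f (F + G) = f F + f G" "\<And>F G. g (F + G) = g F + g G"
    and "\<And>m v. f (Poly_Mapping.single m v) = g (Poly_Mapping.single m v)"
  shows "f F = g F"
  by (induction F rule: poly_mapping_terms_induct) (simp_all add: assms)

lemma term_sum_compose:
  assumes "additive_terms h" and "\<And>x y. g (x + y) = g x + (g y :: 'w::ab_group_add)"
  shows "g (term_sum h F) = term_sum (\<lambda>m v. g (h m v)) F"
  unfolding term_sum_def by (rule additive_sum) (rule assms)

lemma lookup_map: "f 0 = 0 \<Longrightarrow> Poly_Mapping.lookup (Poly_Mapping.map f F) m = f (Poly_Mapping.lookup F m)"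
  by (simp add: map.rep_eq when_def)

lemma map_add_poly_mapping:
  assumes "\<And>x y. f (x + y) = f x + (f y :: 'w::ab_group_add)"
  shows "Poly_Mapping.map f (F + G) = Poly_Mapping.map f F + Poly_Mapping.map f (G :: 'i \<Rightarrow>\<^sub>0 'v::ab_group_add)"
proof -
  have "f 0 = 0" by (rule additive_zero) (rule assms)
  then show ?thesis
    by (intro poly_mapping_eqI) (simp add: lookup_map lookup_add assms)
qed


section \<open>Independence of characters\<close>

text \<open>Dedekind's independence of characters, with vectors as coefficients. Multiplicativity is
  taken along an arbitrary binary operation \<open>f\<close>, so that the lemma serves both the
  powers of one scalar and the monomials evaluated at assignments of scalars.\<close>

lemma (in vector_space) independence_of_characters:
  assumes "finite S"
    and "\<And>m x y. m \<in> S \<Longrightarrow> \<chi> m (f x y) = \<chi> m x * \<chi> m y"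
    and "\<And>m m'. m \<in> S \<Longrightarrow> m' \<in> S \<Longrightarrow> m \<noteq> m' \<Longrightarrow> \<exists>x. \<chi> m x \<noteq> \<chi> m' x"
    and "\<And>m. m \<in> S \<Longrightarrow> \<exists>x. \<chi> m x \<noteq> 0"
    and "\<And>x. (\<Sum>m\<in>S. scale (\<chi> m x) (c m)) = 0"
  shows "m \<in> S \<Longrightarrow> c m = 0"
  using assms
proof (induction S arbitrary: c m rule: finite_induct)
  case (insert m0 S)
  have *: "c m = 0" if "m \<in> S" for m
  proof -
    obtain y where y: "\<chi> m y \<noteq> \<chi> m0 y"
      using insert.prems(3)[of m m0] \<open>m \<in> S\<close> insert.hyps by blast
    \<comment> \<open>The relation at \<open>f x y\<close> minus \<open>\<chi> m0 y\<close> times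
      the relation at \<open>x\<close> loses its \<open>m0\<close> term; the induction hypothesis
      applies to what is left.\<close>
    have "scale (\<chi> m y - \<chi> m0 y) (c m) = 0"
    proof (rule insert.IH[where c = "\<lambda>m. scale (\<chi> m y - \<chi> m0 y) (c m)"])
      fix x
      have "(\<Sum>m\<in>S. scale (\<chi> m x) (scale (\<chi> m y - \<chi> m0 y) (c m)))
          = (\<Sum>m\<in>S. scale (\<chi> m (f x y)) (c m)) - scale (\<chi> m0 y) (\<Sum>m\<in>S. scale (\<chi> m x) (c m))"
        using insert.prems(2)
        by (simp add: scale_sum_right sum_subtractf[symmetric] scale_left_diff_distrib scale_right_diff_distrib mult_ac)
      also have "\<dots> = - scale (\<chi> m0 (f x y)) (c m0) + scale (\<chi> m0 y) (scale (\<chi> m0 x) (c m0))"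
        using insert.prems(5)[of "f x y"] insert.prems(5)[of x] insert.hyps
        by (simp add: add_eq_0_iff scale_minus_right)
      also have "\<dots> = 0"
        using insert.prems(2) by (simp add: mult.commute)
      finally show "(\<Sum>m\<in>S. scale (\<chi> m x) (scale (\<chi> m y - \<chi> m0 y) (c m))) = 0" .
    qed (use insert.prems insert.hyps that in auto)
    with y show ?thesis by simp
  qed
  moreover obtain x where "\<chi> m0 x \<noteq> 0"
    using insert.prems(4)[of m0] by auto
  moreover have "scale (\<chi> m0 x) (c m0) = 0"
    using insert.prems(5)[of x] insert.hyps * by simp
  ultimately show ?case
    using insert.prems(1) by auto
qed auto


section \<open>Polynomial functions and substitution of an operator\<close>

definition poly_value :: "('k \<Rightarrow> 'v \<Rightarrow> 'v) \<Rightarrow> (nat \<Rightarrow>\<^sub>0 'v) \<Rightarrow> 'k::field_char_0 \<Rightarrow> 'v::ab_group_add"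
  where "poly_value s F t = term_sum (\<lambda>n. s (t ^ n)) F"

definition poly_fun :: "('k \<Rightarrow> 'v \<Rightarrow> 'v) \<Rightarrow> ('k::field_char_0 \<Rightarrow> 'v::ab_group_add) \<Rightarrow> bool"
  where "poly_fun s f \<longleftrightarrow> (\<exists>F. f = poly_value s F)"

text \<open>For f t = \<open>\<Sum>n. t^n v_n\<close>, the value \<open>\<Sum>n. h n v_n\<close>; the substitution convention is the case
  where h n involves the n-th power of a derivation.  Meaningful only for polynomial functions f.\<close>

definition subst_power ::
  "('k \<Rightarrow> 'v \<Rightarrow> 'v) \<Rightarrow> (nat \<Rightarrow> 'v \<Rightarrow> 'w) \<Rightarrow> ('k::field_char_0 \<Rightarrow> 'v::ab_group_add) \<Rightarrow> 'w::ab_group_add"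
  where "subst_power s h f = term_sum h (THE F. f = poly_value s F)"

lemma linearD:
  assumes "Vector_Spaces.linear s s' g"
  shows "vector_space s" "vector_space s'" "g (x + y) = g x + g y" "g (s c x) = s' c (g x)"
  using assms by (auto simp: Vector_Spaces.linear_iff)

locale char_0_space = vector_space s for s :: "'k::field_char_0 \<Rightarrow> 'v::ab_group_add \<Rightarrow> 'v"
begin

lemma additive_terms_scale: "additive_terms (\<lambda>n. s (\<chi> n))"
  by (simp add: additive_terms_def scale_right_distrib)

lemma poly_value_add: "poly_value s (F + G) t = poly_value s F t + poly_value s G t"
  unfolding poly_value_def by (rule term_sum_add) (rule additive_terms_scale)

lemma poly_value_single [simp]: "poly_value s (Poly_Mapping.single n v) t = s (t ^ n) v"
  unfolding poly_value_def by (rule term_sum_single) simp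

lemma poly_value_add_fun: "poly_value s (F + G) = (\<lambda>t. poly_value s F t + poly_value s G t)"
  by (simp add: fun_eq_iff poly_value_add)

lemma poly_value_single_fun: "poly_value s (Poly_Mapping.single n v) = (\<lambda>t. s (t ^ n) v)"
  by (simp add: fun_eq_iff)

lemma poly_value_inject: "poly_value s F = poly_value s G \<longleftrightarrow> F = G"
proof
  assume eq: "poly_value s F = poly_value s G"
  define H where "H = F - G"
  have FH: "F = H + G" by (simp add: H_def)
  have H0: "poly_value s H t = 0" for t
    using poly_value_add[of H G t] eq by (simp add: FH[symmetric])
  have "Poly_Mapping.lookup H m = 0" if "m \<in> Poly_Mapping.keys H" for m
  proof (rule independence_of_characters[where f = "(*)" and \<chi> = "\<lambda>n t. t ^ n" and S = "Poly_Mapping.keys H"])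
    fix n n' :: nat assume "n \<noteq> n'"
    \<comment> \<open>In characteristic 0 the single point 2 separates all exponents.\<close>
    then have "(2::'k) ^ n \<noteq> 2 ^ n'"
      using of_nat_eq_iff[of "2 ^ n" "2 ^ n'", where 'a = 'k] by simp
    then show "\<exists>t::'k. t ^ n \<noteq> t ^ n'" by blast
  next
    show "(\<Sum>m\<in>Poly_Mapping.keys H. s (t ^ m) (Poly_Mapping.lookup H m)) = 0" for t
      using H0[of t] by (simp add: poly_value_def term_sum_def)
  next
    show "\<exists>t::'k. t ^ n \<noteq> 0" for n by (rule exI[of _ 1]) simp
  qed (use that in \<open>auto simp: power_mult_distrib\<close>)
  then have "H = 0"
    by (intro poly_mapping_eqI) (auto simp: in_keys_iff)
  then show "F = G" by (simp add: FH)
qed simp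

lemma subst_power_value [simp]: "subst_power s h (poly_value s F) = term_sum h F"
  by (simp add: subst_power_def poly_value_inject)

lemma poly_fun_power: "poly_fun s (\<lambda>t. s (t ^ n) v)"
  unfolding poly_fun_def by (rule exI[of _ "Poly_Mapping.single n v"]) (simp add: fun_eq_iff)

lemma poly_fun_const: "poly_fun s (\<lambda>t. v)"
  using poly_fun_power[of 0] by simp

lemma poly_fun_add: "poly_fun s f \<Longrightarrow> poly_fun s g \<Longrightarrow> poly_fun s (\<lambda>t. f t + g t)"
  unfolding poly_fun_def by (auto simp: poly_value_add_fun[symmetric])

lemma poly_fun_induct [consumes 1, case_names power add]:
  assumes "poly_fun s f"
    and "\<And>n v. P (\<lambda>t. s (t ^ n) v)"
    and "\<And>f g. poly_fun s f \<Longrightarrow> poly_fun s g \<Longrightarrow> P f \<Longrightarrow> P g \<Longrightarrow> P (\<lambda>t. f t + g t)"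
  shows "P f"
proof -
  have "P (poly_value s F)" for F
  proof (induction F rule: poly_mapping_terms_induct)
    case (single m v)
    show ?case using assms(2)[of m v] by (simp add: poly_value_single_fun)
  next
    case (add F G)
    then show ?case
      using assms(3)[of "poly_value s F" "poly_value s G"]
      by (auto simp: poly_value_add_fun poly_fun_def)
  qed
  with assms(1) show ?thesis by (auto simp: poly_fun_def)
qed

lemma subst_power_power:
  "additive_terms h \<Longrightarrow> subst_power s h (\<lambda>t. s (t ^ n) v) = h n v"
  using subst_power_value[of h "Poly_Mapping.single n v"]
  by (simp add: poly_value_single_fun term_sum_single additive_termsD)

lemma subst_power_const: "additive_terms h \<Longrightarrow> subst_power s h (\<lambda>t. v) = h 0 v"
  using subst_power_power[of h 0 v] by simp

lemma subst_power_add: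
  assumes "additive_terms h" "poly_fun s f" "poly_fun s g"
  shows "subst_power s h (\<lambda>t. f t + g t) = subst_power s h f + subst_power s h g"
proof -
  obtain F G where "f = poly_value s F" "g = poly_value s G"
    using assms by (auto simp: poly_fun_def)
  with assms(1) subst_power_value[of h "F + G"] show ?thesis
    by (simp add: poly_value_add_fun term_sum_add)
qed

lemma subst_power_compose:
  assumes "additive_terms h" "\<And>x y. g (x + y) = g x + (g y :: 'w::ab_group_add)"
  shows "g (subst_power s h f) = subst_power s (\<lambda>n v. g (h n v)) f"
  unfolding subst_power_def by (rule term_sum_compose) (rule assms)+

lemma poly_fun_times: "poly_fun s f \<Longrightarrow> poly_fun s (\<lambda>t. s t (f t))"
proof (induction rule: poly_fun_induct)
  case (power n v)
  show ?case using poly_fun_power[of "Suc n" v] by simp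
next
  case (add f g)
  then show ?case by (simp add: scale_right_distrib poly_fun_add)
qed

lemma subst_power_times:
  assumes "additive_terms h" "poly_fun s f"
  shows "subst_power s h (\<lambda>t. s t (f t)) = subst_power s (\<lambda>n. h (Suc n)) f"
proof -
  have h': "additive_terms (\<lambda>n. h (Suc n))"
    using assms(1) by (simp add: additive_terms_def)
  show ?thesis
    using assms(2)
  proof (induction rule: poly_fun_induct)
    case (power n v)
    show ?case
      using subst_power_power[OF assms(1), of "Suc n" v] subst_power_power[OF h', of n v]
      by (simp only: scale_scale power_Suc)
  next
    case (add f g)
    show ?case
      using subst_power_add[OF assms(1) poly_fun_times[OF add(1)] poly_fun_times[OF add(2)]]
        subst_power_add[OF h' add(1,2)] add(3,4)
      by (simp only: scale_right_distrib)
  qed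
qed

lemma poly_fun_linear:
  assumes "Vector_Spaces.linear s' s g" "poly_fun s' f"
  shows "poly_fun s (\<lambda>t. g (f t))"
proof -
  interpret V: char_0_space s' using linearD(1)[OF assms(1)] by (rule char_0_space.intro)
  show ?thesis
    using assms(2)
  proof (induction rule: V.poly_fun_induct)
    case (power n v)
    show ?case using poly_fun_power[of n "g v"] by (simp add: linearD[OF assms(1)])
  next
    case (add f h)
    then show ?case by (simp add: linearD[OF assms(1)] poly_fun_add)
  qed
qed

lemma subst_power_linear:
  assumes "Vector_Spaces.linear s' s g" "poly_fun s' f" "additive_terms h"
  shows "subst_power s h (\<lambda>t. g (f t)) = subst_power s' (\<lambda>n v. h n (g v)) f"
proof -
  interpret V: char_0_space s' using linearD(1)[OF assms(1)] by (rule char_0_space.intro)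
  have h': "additive_terms (\<lambda>n v. h n (g v))"
    using assms(3) by (simp add: additive_terms_def linearD[OF assms(1)])
  show ?thesis
    using assms(2)
  proof (induction rule: V.poly_fun_induct)
    case (power n v)
    show ?case
      using subst_power_power[OF assms(3), of n "g v"] V.subst_power_power[OF h', of n v]
      by (simp add: linearD[OF assms(1)])
  next
    case (add f k)
    show ?case
      using subst_power_add[OF assms(3) poly_fun_linear[OF assms(1) add(1)]
          poly_fun_linear[OF assms(1) add(2)]] V.subst_power_add[OF h' add(1,2)] add(3,4)
      by (simp add: linearD[OF assms(1)])
  qed
qed

lemma linear_scale: "Vector_Spaces.linear s s (s c)"
  using vector_space_axioms by (simp add: Vector_Spaces.linear_iff scale_right_distrib mult.commute)

lemma poly_fun_scale: "poly_fun s f \<Longrightarrow> poly_fun s (\<lambda>t. s c (f t))"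
  by (rule poly_fun_linear[OF linear_scale])

lemma poly_fun_affine: "poly_fun s f \<Longrightarrow> poly_fun s (\<lambda>t. f (a + b * t))"
proof (induction rule: poly_fun_induct)
  case (power n v)
  show ?case
  proof (induction n)
    case 0
    show ?case by (simp add: poly_fun_const)
  next
    case (Suc n)
    have "(\<lambda>t. s ((a + b * t) ^ Suc n) v)
      = (\<lambda>t. s a (s ((a + b * t) ^ n) v) + s b (s t (s ((a + b * t) ^ n) v)))"
      by (simp add: fun_eq_iff scale_left_distrib distrib_right mult_ac)
    then show ?case
      using poly_fun_add[OF poly_fun_scale[OF Suc.IH, of a]
          poly_fun_scale[OF poly_fun_times[OF Suc.IH], of b]] by simp
  qed
next
  case (add f g)
  then show ?case by (simp add: poly_fun_add)
qed

lemma poly_fun_shift: "poly_fun s f \<Longrightarrow> poly_fun s (\<lambda>t. f (a + t))"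
  using poly_fun_affine[of f a 1] by simp

text \<open>When the substituted operator is a scalar \<open>c\<close>, substitution is evaluation
  at \<open>c\<close>. This happens to the derivation once a sesquilinear function is applied, and
  \<open>c = 0\<close> isolates the constant term.\<close>

lemma subst_power_eval:
  assumes "Vector_Spaces.linear s s' g" "poly_fun s f"
  shows "subst_power s (\<lambda>n v. s' (c ^ n) (g v)) f = g (f c)"
proof -
  have h: "additive_terms (\<lambda>n v. s' (c ^ n) (g v))"
    using linearD(2)[OF assms(1)]
    by (simp add: additive_terms_def linearD[OF assms(1)] vector_space.vector_space_assms)
  show ?thesis
    using assms(2)
  proof (induction rule: poly_fun_induct)
    case (power n v)
    show ?case using subst_power_power[OF h] by (simp add: linearD[OF assms(1)])
  next
    case (add f k)
    then show ?case using subst_power_add[OF h add(1,2)] by (simp add: linearD[OF assms(1)])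
  qed
qed

end


section \<open>Evaluation of polynomials\<close>

definition monomial_value :: "(var \<Rightarrow> 'k) \<Rightarrow> (var \<Rightarrow>\<^sub>0 nat) \<Rightarrow> 'k::comm_monoid_mult"
  where "monomial_value \<rho> m = (\<Prod>v\<in>Poly_Mapping.keys m. \<rho> v ^ Poly_Mapping.lookup m v)"

lemma monomial_value_superset:
  "finite S \<Longrightarrow> Poly_Mapping.keys m \<subseteq> S \<Longrightarrow> monomial_value \<rho> m = (\<Prod>v\<in>S. \<rho> v ^ Poly_Mapping.lookup m v)"
  unfolding monomial_value_def by (rule prod.mono_neutral_left) (auto simp: in_keys_iff)

lemma monomial_value_zero [simp]: "monomial_value \<rho> 0 = 1"
  by (simp add: monomial_value_def)

lemma monomial_value_single [simp]: "monomial_value \<rho> (Poly_Mapping.single v n) = \<rho> v ^ n"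
  by (simp add: monomial_value_def)

lemma monomial_value_add: "monomial_value \<rho> (m + n) = monomial_value \<rho> m * monomial_value \<rho> n"
proof -
  let ?S = "Poly_Mapping.keys m \<union> Poly_Mapping.keys n"
  have *: "monomial_value \<rho> l = (\<Prod>v\<in>?S. \<rho> v ^ Poly_Mapping.lookup l v)"
    if "Poly_Mapping.keys l \<subseteq> ?S" for l
    by (rule monomial_value_superset) (use that in auto)
  show ?thesis
    by (subst (1 2 3) *) (use keys_add[of m n] in \<open>auto simp: lookup_add power_add prod.distrib\<close>)
qed

lemma monomial_value_mult: "monomial_value (\<lambda>v. \<rho> v * \<sigma> v) m = monomial_value \<rho> m * monomial_value \<sigma> m"
  by (simp add: monomial_value_def power_mult_distrib prod.distrib)

lemma monomial_value_cong:
  "(\<And>v. v \<in> Poly_Mapping.keys m \<Longrightarrow> \<rho> v = \<sigma> v) \<Longrightarrow> monomial_value \<rho> m = monomial_value \<sigma> m"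
  by (simp add: monomial_value_def)

text \<open>Separates the exponent of \<open>x\<close> from the rest of the monomial, which is how
  the substitution of a derivation for \<open>x\<close> reads it.\<close>

lemma monomial_value_upd:
  "monomial_value (\<rho>(x := t)) m = t ^ Poly_Mapping.lookup m x * monomial_value \<rho> (Poly_Mapping.update x 0 m)"
proof -
  have m: "m = Poly_Mapping.single x (Poly_Mapping.lookup m x) + Poly_Mapping.update x 0 m"
    by (rule poly_mapping_eqI) (simp add: lookup_add lookup_single lookup_update when_def)
  have "monomial_value (\<rho>(x := t)) (Poly_Mapping.update x 0 m) = monomial_value \<rho> (Poly_Mapping.update x 0 m)"
    by (rule monomial_value_cong) (simp add: keys_update)
  then show ?thesis
    by (subst m) (simp add: monomial_value_add)
qed

definition evaluate :: "('k::comm_ring_1 \<Rightarrow> 'v \<Rightarrow> 'v) \<Rightarrow> (var \<Rightarrow> 'k) \<Rightarrow> 'v mpol \<Rightarrow> 'v::comm_monoid_add"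
  where "evaluate s \<rho> F = term_sum (\<lambda>m. s (monomial_value \<rho> m)) (F :: 'v mpol)"

text \<open>Values beyond the given list are irrelevant for polynomials in \<open>lam_polys\<close>; they are set to 0.\<close>

definition point :: "'k list \<Rightarrow> var \<Rightarrow> 'k::zero"
  where "point ls v = (case v of Lam i \<Rightarrow> if i < length ls then ls ! i else 0 | X i \<Rightarrow> 0)"

lemma monom_mult_eq: "monom_mult m F = term_sum (\<lambda>n. Poly_Mapping.single (m + n)) F"
  by (simp add: monom_mult_def term_sum_def)

lemma subst_inside_eq: "subst_inside x D F =
  term_sum (\<lambda>m v. Poly_Mapping.single (Poly_Mapping.update x 0 m) ((D ^^ Poly_Mapping.lookup m x) v)) F"
  by (simp add: subst_inside_def term_sum_def)

lemma funpow_linear: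
  assumes "Vector_Spaces.linear s s D"
  shows "Vector_Spaces.linear s s (D ^^ n)"
proof (induction n)
  case 0
  then show ?case
    using assms by (simp add: Vector_Spaces.linear_iff)
next
  case (Suc n)
  then show ?case
    using assms by (simp add: Vector_Spaces.linear_iff)
qed

section \<open>Evaluation of the formal operations on polynomials\<close>

context char_0_space
begin

lemma evaluate_add: "evaluate s \<rho> (F + G) = evaluate s \<rho> F + evaluate s \<rho> G"
  unfolding evaluate_def by (rule term_sum_add) (rule additive_terms_scale)

lemma evaluate_zero [simp]: "evaluate s \<rho> 0 = 0"
  by (simp add: evaluate_def)

lemma evaluate_uminus: "evaluate s \<rho> (- F) = - evaluate s \<rho> F"
  by (rule additive_uminus) (rule evaluate_add)

lemma evaluate_diff: "evaluate s \<rho> (F - G) = evaluate s \<rho> F - evaluate s \<rho> G"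
  using evaluate_add[of \<rho> F "- G"] by (simp add: evaluate_uminus)

lemma evaluate_sum: "evaluate s \<rho> (\<Sum>i\<in>I. F i) = (\<Sum>i\<in>I. evaluate s \<rho> (F i))"
  by (rule additive_sum) (rule evaluate_add)

lemma evaluate_single [simp]: "evaluate s \<rho> (Poly_Mapping.single m v) = s (monomial_value \<rho> m) v"
  unfolding evaluate_def by (rule term_sum_single) simp

lemma evaluate_eqI:
  assumes "\<And>\<rho>. evaluate s \<rho> F = evaluate s \<rho> G"
  shows "F = G"
proof -
  define H where "H = F - G"
  have "Poly_Mapping.lookup H m = 0" if "m \<in> Poly_Mapping.keys H" for m
  proof (rule independence_of_characters[where f = "\<lambda>\<rho> \<sigma> v. \<rho> v * \<sigma> v"
        and \<chi> = "\<lambda>m \<rho>. monomial_value \<rho> m" and S = "Poly_Mapping.keys H"])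
    fix m n :: "var \<Rightarrow>\<^sub>0 nat" assume "m \<noteq> n"
    then obtain v where v: "Poly_Mapping.lookup m v \<noteq> Poly_Mapping.lookup n v"
      by (metis poly_mapping_eqI)
    \<comment> \<open>Setting one indeterminate to 2 and all others to 1 reads off its
      exponent.\<close>
    have *: "monomial_value ((\<lambda>_. 1)(v := 2)) l = (of_nat (2 ^ Poly_Mapping.lookup l v) :: 'k)" for l
      by (subst monomial_value_upd) (simp add: monomial_value_def)
    show "\<exists>\<rho>. monomial_value \<rho> m \<noteq> (monomial_value \<rho> n :: 'k)"
      by (rule exI[of _ "(\<lambda>_. 1)(v := 2)"]) (use v in \<open>simp only: * of_nat_eq_iff, simp\<close>)
  next
    show "\<exists>\<rho>. monomial_value \<rho> m \<noteq> (0::'k)" for m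
      by (rule exI[of _ "\<lambda>_. 1"]) (simp add: monomial_value_def)
  next
    show "(\<Sum>m\<in>Poly_Mapping.keys H. s (monomial_value \<rho> m) (Poly_Mapping.lookup H m)) = 0" for \<rho>
      using assms[of \<rho>] evaluate_diff[of \<rho> F G]
      by (simp add: evaluate_def term_sum_def H_def)
  qed (use that in \<open>auto simp: monomial_value_mult\<close>)
  then have "H = 0"
    by (intro poly_mapping_eqI) (auto simp: in_keys_iff)
  then show ?thesis by (simp add: H_def)
qed

lemma evaluate_cong:
  assumes "F \<in> lam_polys k" "\<And>i. i < k \<Longrightarrow> \<rho> (Lam i) = \<sigma> (Lam i)"
  shows "evaluate s \<rho> F = evaluate s \<sigma> F"
  unfolding evaluate_def term_sum_def
proof (rule sum.cong)
  fix m assume "m \<in> Poly_Mapping.keys F"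
  then have "Poly_Mapping.keys m \<subseteq> Lam ` {..<k}"
    using assms(1) by (auto simp: lam_polys_def)
  then have "monomial_value \<rho> m = monomial_value \<sigma> m"
    using assms(2) by (intro monomial_value_cong) auto
  then show "s (monomial_value \<rho> m) (Poly_Mapping.lookup F m) = s (monomial_value \<sigma> m) (Poly_Mapping.lookup F m)"
    by simp
qed simp

lemma evaluate_point:
  assumes "F \<in> lam_polys k"
  shows "evaluate s (point (map (\<lambda>i. \<rho> (Lam i)) [0..<k])) F = evaluate s \<rho> F"
  by (rule evaluate_cong[OF assms]) (simp add: point_def)

lemma evaluate_map:
  assumes "Vector_Spaces.linear s s' D"
  shows "evaluate s' \<rho> (Poly_Mapping.map D F) = D (evaluate s \<rho> F)"
proof -
  interpret W: char_0_space s' using linearD(2)[OF assms] by (rule char_0_space.intro)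
  have D0: "D 0 = 0" by (rule additive_zero) (rule linearD[OF assms])
  show ?thesis
    by (rule additive_eqI[where f = "\<lambda>F. evaluate s' \<rho> (Poly_Mapping.map D F)"])
       (simp_all add: map_add_poly_mapping linearD[OF assms] W.evaluate_add evaluate_add map_single D0)
qed

lemma evaluate_coeff_scale: "evaluate s \<rho> (coeff_scale s c F) = s c (evaluate s \<rho> F)"
  unfolding coeff_scale_def by (rule evaluate_map) (rule linear_scale)

lemma additive_terms_single: "additive_terms (\<lambda>n v. Poly_Mapping.single (g n) v)"
  by (simp add: additive_terms_def single_add)

lemma monom_mult_add: "monom_mult m (F + G) = monom_mult m F + monom_mult m (G :: 'v mpol)"
  unfolding monom_mult_eq by (rule term_sum_add) (rule additive_terms_single)

lemma monom_mult_single: "monom_mult m (Poly_Mapping.single n v) = Poly_Mapping.single (m + n) v"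
  unfolding monom_mult_eq by (rule term_sum_single) simp

lemma evaluate_monom_mult: "evaluate s \<rho> (monom_mult m F) = s (monomial_value \<rho> m) (evaluate s \<rho> F)"
  by (rule additive_eqI[where f = "\<lambda>F. evaluate s \<rho> (monom_mult m F)"])
     (simp_all add: monom_mult_add monom_mult_single evaluate_add scale_right_distrib monomial_value_add)

lemma evaluate_var_mult: "evaluate s \<rho> (var_mult v F) = s (\<rho> v) (evaluate s \<rho> F)"
  by (simp add: var_mult_def evaluate_monom_mult)

lemma poly_fun_evaluate: "poly_fun s (\<lambda>t. evaluate s (\<rho>(x := t)) F)"
proof (induction F rule: poly_mapping_terms_induct)
  case (single m v)
  show ?case
    using poly_fun_power[of "Poly_Mapping.lookup m x" "s (monomial_value \<rho> (Poly_Mapping.update x 0 m)) v"]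
    by (simp add: monomial_value_upd mult.commute del: fun_upd_apply)
next
  case (add F G)
  then show ?case by (simp add: evaluate_add poly_fun_add)
qed

text \<open>The terms on the right are those of the formal substitution with the remaining
  indeterminates evaluated; from here on a substitution is handled through its function of
  \<open>t\<close>.\<close>

lemma subst_power_evaluate:
  assumes "additive_terms h"
  shows "subst_power s h (\<lambda>t. evaluate s (\<rho>(x := t)) F)
    = term_sum (\<lambda>m v. h (Poly_Mapping.lookup m x) (s (monomial_value \<rho> (Poly_Mapping.update x 0 m)) v)) F"
proof -
  have h': "additive_terms (\<lambda>m v. h (Poly_Mapping.lookup m x) (s (monomial_value \<rho> (Poly_Mapping.update x 0 m)) v))"
    using assms by (simp add: additive_terms_def scale_right_distrib)
  show ?thesis
  proof (rule additive_eqI[where f = "\<lambda>F. subst_power s h (\<lambda>t. evaluate s (\<rho>(x := t)) F)"])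
    fix m v
    show "subst_power s h (\<lambda>t. evaluate s (\<rho>(x := t)) (Poly_Mapping.single m v)) =
      term_sum (\<lambda>m v. h (Poly_Mapping.lookup m x) (s (monomial_value \<rho> (Poly_Mapping.update x 0 m)) v))
        (Poly_Mapping.single m v)"
      using subst_power_power[OF assms, of "Poly_Mapping.lookup m x" "s (monomial_value \<rho> (Poly_Mapping.update x 0 m)) v"]
      by (simp add: monomial_value_upd term_sum_single additive_termsD[OF h'] additive_termsD[OF assms])
  qed (simp_all add: evaluate_add subst_power_add assms poly_fun_evaluate term_sum_add h')
qed

lemma evaluate_subst_inside:
  assumes "Vector_Spaces.linear s s D"
  shows "evaluate s \<rho> (subst_inside x D F) = subst_power s (\<lambda>n. D ^^ n) (\<lambda>t. evaluate s (\<rho>(x := t)) F)"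
proof -
  have D: "additive_terms (\<lambda>n. D ^^ n)"
    by (simp add: additive_terms_def linearD[OF funpow_linear[OF assms]])
  have "evaluate s \<rho> (subst_inside x D F) = term_sum (\<lambda>m v. evaluate s \<rho>
      (Poly_Mapping.single (Poly_Mapping.update x 0 m) ((D ^^ Poly_Mapping.lookup m x) v))) F"
    unfolding subst_inside_eq
    by (rule term_sum_compose)
       (simp_all add: additive_terms_def single_add linearD[OF funpow_linear[OF assms]] evaluate_add)
  then show ?thesis
    by (simp add: subst_power_evaluate[OF D] linearD[OF funpow_linear[OF assms]])
qed

text \<open>After evaluation the indeterminates are scalars, and linearity over the ground field
  lets them pass through \<open>f\<close>. Linearity is asked of \<open>f\<close> only after
  evaluation at the assignment in question.\<close>

lemma evaluate_lin_ext:
  assumes "Vector_Spaces.linear s s' (\<lambda>v. evaluate s' \<rho> (f v))"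
  shows "evaluate s' \<rho> (lin_ext f F) = evaluate s' \<rho> (f (evaluate s \<rho> F))"
proof -
  interpret W: char_0_space s' using linearD(2)[OF assms] by (rule char_0_space.intro)
  note lin = linearD(3,4)[OF assms]
  have "evaluate s' \<rho> (lin_ext f F)
    = term_sum (\<lambda>m v. s' (monomial_value \<rho> m) (evaluate s' \<rho> (f v))) F"
    unfolding lin_ext_def term_sum_def by (simp add: W.evaluate_sum W.evaluate_monom_mult)
  also have "\<dots> = term_sum (\<lambda>m v. evaluate s' \<rho> (f (s (monomial_value \<rho> m) v))) F"
    by (simp add: lin)
  also have "\<dots> = evaluate s' \<rho> (f (evaluate s \<rho> F))"
    unfolding evaluate_def[of s]
    by (rule term_sum_compose[symmetric]) (simp_all add: additive_terms_scale lin)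
  finally show ?thesis .
qed

end

text \<open>The derivation may act on the value of \<open>f\<close> instead of its coefficients
  because it is linear over the ground field. Only \<open>Q\<close> keeps its dependence on
  \<open>x\<close>, as a function of \<open>t\<close>.\<close>

lemma (in char_0_space) evaluate_subst_factor:
  fixes sf :: "'k \<Rightarrow> 'f::ab_group_add \<Rightarrow> 'f" and sw :: "'k \<Rightarrow> 'w::ab_group_add \<Rightarrow> 'w"
  assumes b: "\<And>v. Vector_Spaces.linear s sw (\<lambda>q. b q v)" "\<And>q. Vector_Spaces.linear sf sw (b q)"
    and D: "Vector_Spaces.linear sf sf D"
  shows "evaluate sw \<rho> (subst_factor b x D Q f)
    = subst_power s (\<lambda>n q. b q ((D ^^ n) (evaluate sf \<rho> f))) (\<lambda>t. evaluate s (\<rho>(x := t)) Q)"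
proof -
  interpret F: char_0_space sf using linearD(2)[OF D] by (rule char_0_space.intro)
  interpret W: char_0_space sw using linearD(2)[OF b(1)] by (rule char_0_space.intro)
  note lin = linearD(3,4)[OF b(1)] linearD(3,4)[OF b(2)]
    linearD(3,4)[OF D] linearD(3,4)[OF funpow_linear[OF D]]
  have h: "additive_terms (\<lambda>n q. b q ((D ^^ n) (evaluate sf \<rho> f)))"
    by (simp add: additive_terms_def lin)
  have bD: "Vector_Spaces.linear sf sw (\<lambda>v. b q ((D ^^ n) v))" for q n
    using F.vector_space_axioms W.vector_space_axioms by (simp add: Vector_Spaces.linear_iff lin)
  have "evaluate sw \<rho> (subst_factor b x D Q f) = term_sum (\<lambda>m q. term_sum (\<lambda>n v.
      sw (monomial_value \<rho> (Poly_Mapping.update x 0 m)) (b q ((D ^^ Poly_Mapping.lookup m x) (sf (monomial_value \<rho> n) v)))) f) Q"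
    unfolding subst_factor_def term_sum_def
    by (simp add: W.evaluate_sum monomial_value_add lin)
  also have "\<dots> = term_sum (\<lambda>m q. sw (monomial_value \<rho> (Poly_Mapping.update x 0 m))
      (b q ((D ^^ Poly_Mapping.lookup m x) (evaluate sf \<rho> f)))) Q"
    unfolding evaluate_def
    by (subst term_sum_compose[where g = "\<lambda>v. sw c (b q ((D ^^ n) v))" for c q n])
       (simp_all add: F.additive_terms_scale lin W.scale_right_distrib)
  also have "\<dots> = subst_power s (\<lambda>n q. b q ((D ^^ n) (evaluate sf \<rho> f))) (\<lambda>t. evaluate s (\<rho>(x := t)) Q)"
    by (simp add: subst_power_evaluate[OF h] lin)
  finally show ?thesis .
qed

section \<open>Scalar polynomials and their substitution for the lambdas\<close>

interpretation scalars: char_0_space "(*) :: 'k::field_char_0 \<Rightarrow> 'k \<Rightarrow> 'k"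
  by unfold_locales (simp_all add: algebra_simps)

abbreviation scalar_value :: "(var \<Rightarrow> 'k) \<Rightarrow> 'k mpol \<Rightarrow> 'k::field_char_0"
  where "scalar_value \<rho> q \<equiv> evaluate (*) \<rho> q"

lemma scalar_value_mult: "scalar_value \<rho> (p * q) = scalar_value \<rho> p * scalar_value \<rho> q"
proof (rule additive_eqI[where f = "\<lambda>p. scalar_value \<rho> (p * q)"])
  fix m c
  show "scalar_value \<rho> (Poly_Mapping.single m c * q) = scalar_value \<rho> (Poly_Mapping.single m c) * scalar_value \<rho> q"
    by (rule additive_eqI[where f = "\<lambda>q. scalar_value \<rho> (Poly_Mapping.single m c * q)"])
       (simp_all add: distrib_left scalars.evaluate_add mult_single monomial_value_add)
qed (simp_all add: distrib_right scalars.evaluate_add)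

lemma scalar_value_one [simp]: "scalar_value \<rho> 1 = 1"
  using scalars.evaluate_single[of \<rho> 0 1] by simp

lemma scalar_value_power: "scalar_value \<rho> (p ^ n) = scalar_value \<rho> p ^ n"
  by (induction n) (simp_all add: scalar_value_mult)

lemma scalar_value_prod: "scalar_value \<rho> (\<Prod>i\<in>I. p i) = (\<Prod>i\<in>I. scalar_value \<rho> (p i))"
  by (induction I rule: infinite_finite_induct) (simp_all add: scalar_value_mult)

lemma scalar_value_pvar [simp]: "scalar_value \<rho> (pvar v) = \<rho> v"
  by (simp add: pvar_def)

lemmas scalar_value_simps =
  scalars.evaluate_add scalars.evaluate_diff scalars.evaluate_uminus

context char_0_space
begin

lemma evaluate_poly_times_vec: "evaluate s \<rho> (poly_times_vec s q v) = s (scalar_value \<rho> q) v"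
  unfolding poly_times_vec_def
  by (rule scalars.evaluate_map)
     (simp add: Vector_Spaces.linear_iff scale_left_distrib vector_space_axioms scalars.vector_space_axioms)

text \<open>An indeterminate outside the list is dropped by \<open>at_poly\<close> but set to 0 by
  \<open>point\<close>; membership in \<open>lam_polys\<close> rules out this discrepancy.\<close>

lemma evaluate_at_poly:
  assumes "F \<in> lam_polys (length qs)"
  shows "evaluate s \<rho> (at_poly s qs F) = evaluate s (point (map (scalar_value \<rho>) qs)) F"
  unfolding at_poly_def evaluate_sum evaluate_poly_times_vec evaluate_def[of s _ F] term_sum_def
proof (rule sum.cong)
  fix m assume "m \<in> Poly_Mapping.keys F"
  then have "Poly_Mapping.keys m \<subseteq> Lam ` {..<length qs}"
    using assms by (auto simp: lam_polys_def)
  then have "monomial_value (point (map (scalar_value \<rho>) qs)) m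
    = (\<Prod>v\<in>Lam ` {..<length qs}. point (map (scalar_value \<rho>) qs) v ^ Poly_Mapping.lookup m v)"
    by (intro monomial_value_superset) auto
  also have "\<dots> = scalar_value \<rho> (\<Prod>i<length qs. (qs ! i) ^ Poly_Mapping.lookup m (Lam i))"
    by (subst prod.reindex) (auto simp: inj_on_def scalar_value_prod scalar_value_power point_def)
  finally show "s (scalar_value \<rho> (\<Prod>i<length qs. (qs ! i) ^ Poly_Mapping.lookup m (Lam i))) (Poly_Mapping.lookup F m)
    = s (monomial_value (point (map (scalar_value \<rho>) qs)) m) (Poly_Mapping.lookup F m)"
    by simp
qed simp

end


section \<open>Polynomials in the lambdas\<close>

lemma lam_polys_single: "Poly_Mapping.keys m \<subseteq> Lam ` {..<k} \<Longrightarrow> Poly_Mapping.single m v \<in> lam_polys k"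
  by (auto simp: lam_polys_def)

lemma lam_polys_zero [simp]: "0 \<in> lam_polys k"
  by (simp add: lam_polys_def)

lemma lam_polys_add:
  assumes "F \<in> lam_polys k" "G \<in> lam_polys k"
  shows "F + G \<in> lam_polys k"
  using assms keys_add[of F G] by (auto simp: lam_polys_def)

lemma lam_polys_sum:
  "(\<And>i. i \<in> I \<Longrightarrow> F i \<in> lam_polys k) \<Longrightarrow> (\<Sum>i\<in>I. F i) \<in> lam_polys k"
  by (induction I rule: infinite_finite_induct) (auto intro: lam_polys_add)

lemma lam_polys_map: "F \<in> lam_polys k \<Longrightarrow> Poly_Mapping.map f F \<in> lam_polys k"
  by (auto simp: lam_polys_def in_keys_iff map.rep_eq when_def split: if_splits)

lemma lam_polys_coeff_scale: "F \<in> lam_polys k \<Longrightarrow> coeff_scale s c F \<in> lam_polys k"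
  unfolding coeff_scale_def by (rule lam_polys_map)

lemma coeff_scale_zero [simp]: "coeff_scale s c 0 = 0"
  by (simp add: coeff_scale_def map_eq_zero_iff)

lemma lam_polys_monom_mult:
  assumes "F \<in> lam_polys k" "Poly_Mapping.keys m \<subseteq> Lam ` {..<k}"
  shows "monom_mult m F \<in> lam_polys k"
  unfolding monom_mult_def
  using assms keys_add[of m] by (intro lam_polys_sum lam_polys_single) (fastforce simp: lam_polys_def)

lemma lam_polys_lin_ext:
  assumes "F \<in> lam_polys k" "\<And>v. f v \<in> lam_polys k"
  shows "lin_ext f F \<in> lam_polys k"
  unfolding lin_ext_def
  using assms by (intro lam_polys_sum lam_polys_monom_mult) (auto simp: lam_polys_def)

lemma lam_polys_mult:
  assumes "p \<in> lam_polys k" "q \<in> lam_polys k"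
  shows "p * q \<in> lam_polys k"
proof -
  have "Poly_Mapping.keys m \<subseteq> Lam ` {..<k}" if m: "m \<in> Poly_Mapping.keys (p * q)" for m
  proof -
    obtain a b where "m = a + b" "a \<in> Poly_Mapping.keys p" "b \<in> Poly_Mapping.keys q"
      using keys_mult[of p q] m by auto
    then show ?thesis
      using assms keys_add[of a b] by (fastforce simp: lam_polys_def)
  qed
  then show ?thesis by (simp add: lam_polys_def)
qed

lemma lam_polys_one [simp]: "1 \<in> lam_polys k"
  by (simp add: lam_polys_def)

lemma lam_polys_power: "p \<in> lam_polys k \<Longrightarrow> p ^ n \<in> lam_polys k"
  by (induction n) (simp_all add: lam_polys_mult)

lemma lam_polys_prod:
  "(\<And>i. i \<in> I \<Longrightarrow> p i \<in> lam_polys k) \<Longrightarrow> (\<Prod>i\<in>I. p i) \<in> lam_polys k"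
  by (induction I rule: infinite_finite_induct) (simp_all add: lam_polys_mult)

lemma lam_polys_Lam: "i < k \<Longrightarrow> \<Lambda> i \<in> lam_polys k"
  by (simp add: pvar_def lam_polys_single)

lemma lam_polys_at_poly:
  assumes "\<And>q. q \<in> set qs \<Longrightarrow> q \<in> lam_polys k"
  shows "at_poly s qs F \<in> lam_polys k"
  unfolding at_poly_def poly_times_vec_def
  using assms by (intro lam_polys_sum lam_polys_map lam_polys_prod lam_polys_power) simp


section \<open>The Chevalley--Eilenberg differential of a Leibniz algebra\<close>

text \<open>The sign \<open>(-1) ^ n\<close> without a ground field: in this section the values form
  only an abelian group.\<close>

definition alternate :: "nat \<Rightarrow> 'm \<Rightarrow> 'm::ab_group_add"
  where "alternate n m = (if even n then m else - m)"

lemma alternate_simps [simp]: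
  "alternate 0 m = m" "alternate (Suc n) m = - alternate n m" "alternate n 0 = (0::'m::ab_group_add)"
  "alternate n (- m) = - alternate n (m::'m)" "alternate n (m + m') = alternate n m + alternate n (m'::'m)"
  "alternate n (alternate n m) = m"
  by (simp_all add: alternate_def)

section \<open>Skew-symmetric functions of lists\<close>

definition skew :: "('x list \<Rightarrow> 'm::ab_group_add) \<Rightarrow> bool"
  where "skew \<phi> \<longleftrightarrow> (\<forall>ws x y zs. \<phi> (ws @ x # y # zs) = - \<phi> (ws @ y # x # zs))"

lemma skewD: "skew \<phi> \<Longrightarrow> \<phi> (ws @ x # y # zs) = - \<phi> (ws @ y # x # zs)"
  unfolding skew_def by blast

lemma skew_Cons: "skew \<phi> \<Longrightarrow> skew (\<lambda>ws. \<phi> (x # ws))"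
  unfolding skew_def by (metis append_Cons)

lemma skew_move: "skew \<phi> \<Longrightarrow> \<phi> (ws @ x # ys @ zs) = alternate (length ys) (\<phi> (ws @ ys @ x # zs))"
proof (induction ys arbitrary: ws)
  case (Cons y ys)
  have "\<phi> (ws @ x # (y # ys) @ zs) = - \<phi> ((ws @ [y]) @ x # ys @ zs)"
    using skewD[OF Cons.prems, of ws x y "ys @ zs"] by simp
  also have "\<dots> = - alternate (length ys) (\<phi> ((ws @ [y]) @ ys @ x # zs))"
    by (simp only: Cons.IH[OF Cons.prems])
  finally show ?case by simp
qed simp

text \<open>Moving \<open>y\<close> to the right over \<open>ys\<close> and \<open>x\<close> to the
  left over \<open>ys\<close> costs the same sign twice; the one swap in between leaves the
  minus.\<close>

lemma skew_exchange:
  assumes "skew \<phi>"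
  shows "\<phi> (ws @ y # ys @ x # zs) = - \<phi> (ws @ x # ys @ y # zs)"
proof -
  have "\<phi> (ws @ y # ys @ x # zs) = alternate (length ys) (\<phi> (ws @ ys @ y # x # zs))"
    by (rule skew_move[OF assms])
  also have "\<dots> = - alternate (length ys) (\<phi> (ws @ ys @ x # y # zs))"
    using skewD[OF assms, of "ws @ ys" y x zs] by simp
  also have "\<dots> = - \<phi> (ws @ x # ys @ y # zs)"
    by (simp add: skew_move[OF assms, of ws x])
  finally show ?thesis .
qed

lemma permute_list_transpose:
  "permute_list (Transposition.transpose (length ws) (length ws + Suc (length ys))) (ws @ x # ys @ y # zs)
    = ws @ y # ys @ x # zs" (is "permute_list ?t ?xs = _")
proof (rule nth_equalityI)
  fix i assume i: "i < length (permute_list ?t ?xs)"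
  have "?t permutes {..<length ?xs}"
    by (intro permutes_swap_id) auto
  then have "permute_list ?t ?xs ! i = ?xs ! ?t i"
    using i by (intro permute_list_nth) simp_all
  also have "\<dots> = (ws @ y # ys @ x # zs) ! i"
    by (auto simp: Transposition.transpose_def nth_append nth_Cons' not_less)
  finally show "permute_list ?t ?xs ! i = (ws @ y # ys @ x # zs) ! i" .
qed simp

lemma skew_transpose:
  assumes "skew \<phi>" "a < b" "b < length xs"
  shows "\<phi> (permute_list (Transposition.transpose a b) xs) = - \<phi> xs"
proof -
  define ws ys zs where "ws = take a xs" and "ys = take (b - Suc a) (drop (Suc a) xs)"
    and "zs = drop (Suc b) xs"
  have "drop (Suc a) xs = ys @ xs ! b # zs"
    using assms(2,3) id_take_nth_drop[of "b - Suc a" "drop (Suc a) xs"]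
    by (simp add: ys_def zs_def)
  then have xs: "xs = ws @ xs ! a # ys @ xs ! b # zs"
    using assms(2,3) id_take_nth_drop[of a xs] by (simp add: ws_def)
  moreover have "length ws = a" "length ws + Suc (length ys) = b"
    using assms(2,3) by (simp_all add: ws_def ys_def)
  ultimately have "permute_list (Transposition.transpose a b) xs = ws @ xs ! b # ys @ xs ! a # zs"
    by (metis permute_list_transpose)
  then show ?thesis
    using skew_exchange[OF assms(1)] xs by metis
qed

lemma skew_permute:
  assumes "skew \<phi>" "\<pi> permutes {..<length xs}"
  shows "\<phi> (permute_list \<pi> xs) = (if sign \<pi> = 1 then \<phi> xs else - \<phi> xs)"
  using finite_lessThan assms(2)
proof (induction rule: permutes_rev_induct)
  case id
  show ?case by (simp add: sign_id)
next
  case (swap a b p)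
  have t: "Transposition.transpose a b permutes {..<length xs}"
    using swap by (intro permutes_swap_id) auto
  have "\<phi> (permute_list (p \<circ> Transposition.transpose a b) xs)
    = \<phi> (permute_list (Transposition.transpose a b) (permute_list p xs))"
    by (simp add: permute_list_compose[OF t])
  also have "\<dots> = - \<phi> (permute_list p xs)"
  proof (cases "a < b")
    case True
    then show ?thesis using skew_transpose[OF assms(1) True, of "permute_list p xs"] swap by simp
  next
    case False
    then have "b < a" using swap by simp
    then show ?thesis
      using skew_transpose[OF assms(1), of b a "permute_list p xs"] swap
      by (simp add: transpose_commute)
  qed
  moreover have "sign (p \<circ> Transposition.transpose a b) = - sign p"
    using swap t by (subst sign_compose) (auto simp: sign_swap_id permutation_swap_id
        intro!: permutes_imp_permutation[of "{..<length xs}"])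
  ultimately show ?case
    using swap.IH by (simp only:) (auto simp: sign_def)
qed

section \<open>Lie derivative and differential by recursion on lists\<close>

locale leibniz_operations =
  fixes brk :: "'x \<Rightarrow> 'x \<Rightarrow> 'x" and op :: "'x \<Rightarrow> 'm \<Rightarrow> 'm::ab_group_add"
begin

text \<open>With i_y for contraction, which puts \<open>y\<close> in front, the recursion reads i_y
  L_x = L_x i_y - i_[x,y]. Each bracket stays in the place of the argument it replaces, so the
  formula makes sense before any skew-symmetry.\<close>

fun lie_derivative :: "'x \<Rightarrow> ('x list \<Rightarrow> 'm) \<Rightarrow> 'x list \<Rightarrow> 'm" where
  "lie_derivative x \<phi> [] = op x (\<phi> [])"
| "lie_derivative x \<phi> (y # zs) = lie_derivative x (\<lambda>ws. \<phi> (y # ws)) zs - \<phi> (brk x y # zs)"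

text \<open>The recursion is Cartan's formula: contraction with x turns the differential into
  the Lie derivative along x.\<close>

fun differential :: "('x list \<Rightarrow> 'm) \<Rightarrow> 'x list \<Rightarrow> 'm" where
  "differential \<phi> [] = 0"
| "differential \<phi> (x # xs) = lie_derivative x \<phi> xs - differential (\<lambda>ws. \<phi> (x # ws)) xs"

text \<open>The arguments carry no addition, so the identity has to be stated through the values of
  \<open>\<phi>\<close>, in every slot.\<close>

definition jacobi :: "('x list \<Rightarrow> 'm) \<Rightarrow> bool"
  where "jacobi \<phi> \<longleftrightarrow> (\<forall>ws x y z zs. \<phi> (ws @ brk x (brk y z) # zs) =
    \<phi> (ws @ brk y (brk x z) # zs) + \<phi> (ws @ brk (brk x y) z # zs))"

definition bracket_skew :: "('x list \<Rightarrow> 'm) \<Rightarrow> bool"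
  where "bracket_skew \<phi> \<longleftrightarrow> (\<forall>ws x y zs. \<phi> (ws @ brk x y # zs) = - \<phi> (ws @ brk y x # zs))"

definition chevalley_eilenberg :: "('x list \<Rightarrow> 'm) \<Rightarrow> 'x list \<Rightarrow> 'm"
  where "chevalley_eilenberg \<phi> xs =
    (\<Sum>i<length xs. alternate i (op (xs ! i) (\<phi> (nths xs (- {i})))))
    + (\<Sum>j<length xs. \<Sum>i<j. alternate (i + j) (\<phi> (brk (xs ! i) (xs ! j) # nths xs (- {i, j}))))"

lemma jacobi_Cons: "jacobi \<phi> \<Longrightarrow> jacobi (\<lambda>ws. \<phi> (x # ws))"
  unfolding jacobi_def by (metis append_Cons)

lemma bracket_skew_Cons: "bracket_skew \<phi> \<Longrightarrow> bracket_skew (\<lambda>ws. \<phi> (x # ws))"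
  unfolding bracket_skew_def by (metis append_Cons)

end

locale leibniz_module = leibniz_operations brk op
  for brk :: "'x \<Rightarrow> 'x \<Rightarrow> 'x" and op :: "'x \<Rightarrow> 'm \<Rightarrow> 'm::ab_group_add" +
  assumes op_add: "op x (m + n) = op x m + op x n"
    and op_bracket: "op (brk x y) m = op x (op y m) - op y (op x m)"
begin

lemma op_zero [simp]: "op x 0 = 0"
  by (rule additive_zero) (rule op_add)

lemma op_uminus: "op x (- m) = - op x m"
  by (rule additive_uminus) (rule op_add)

lemma op_diff: "op x (m - n) = op x m - op x n"
  using op_add[of x m "- n"] by (simp add: op_uminus)

lemma lie_derivative_diff:
  "lie_derivative x (\<lambda>ws. \<phi> ws - \<psi> ws) zs = lie_derivative x \<phi> zs - lie_derivative x \<psi> zs"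
  by (induction zs arbitrary: \<phi> \<psi>) (simp_all add: op_diff)

lemma lie_derivative_uminus: "lie_derivative x (\<lambda>ws. - \<phi> ws) zs = - lie_derivative x \<phi> zs"
  by (induction zs arbitrary: \<phi>) (simp_all add: op_uminus)

lemma differential_diff:
  "differential (\<lambda>ws. \<phi> ws - \<psi> ws) xs = differential \<phi> xs - differential \<psi> xs"
  by (induction xs arbitrary: \<phi> \<psi>) (simp_all add: lie_derivative_diff)

lemma differential_uminus: "differential (\<lambda>ws. - \<phi> ws) xs = - differential \<phi> xs"
  by (induction xs arbitrary: \<phi>) (simp_all add: lie_derivative_uminus)

text \<open>Terms with one bracket on the first argument \<open>z\<close> occur in both products and
  cancel; those with two brackets combine by the Jacobi identity in that slot.\<close>

lemma lie_derivative_commutator: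
  "jacobi \<phi> \<Longrightarrow> lie_derivative x (lie_derivative y \<phi>) zs - lie_derivative y (lie_derivative x \<phi>) zs
    = lie_derivative (brk x y) \<phi> zs"
proof (induction zs arbitrary: \<phi>)
  case Nil
  show ?case by (simp add: op_bracket)
next
  case (Cons z zs)
  have "\<phi> (brk x (brk y z) # zs) = \<phi> (brk y (brk x z) # zs) + \<phi> (brk (brk x y) z # zs)"
    using Cons.prems[unfolded jacobi_def] by (metis append_Nil)
  then show ?case
    using Cons.IH[OF jacobi_Cons[OF Cons.prems], of z]
    by (simp add: lie_derivative_diff algebra_simps)
qed

text \<open>On \<open>y # ys\<close> the difference of the two sides is the defect of the commutator
  formula for \<open>x\<close> and \<open>y\<close>, which is 0, minus the same difference for the
  contraction with \<open>y\<close>.\<close>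

lemma lie_derivative_differential:
  "jacobi \<phi> \<Longrightarrow> lie_derivative x (differential \<phi>) xs = differential (lie_derivative x \<phi>) xs"
proof (induction xs arbitrary: \<phi> x)
  case (Cons y ys)
  show ?case
    using Cons.IH[OF jacobi_Cons[OF Cons.prems], of x y] lie_derivative_commutator[OF Cons.prems, of x y ys]
    by (simp add: lie_derivative_diff differential_diff algebra_simps)
qed simp

text \<open>With d for the differential, two unfoldings turn d d on \<open>x # xs\<close> into L_x d
  - d L_x plus d d of the contraction with \<open>x\<close>.\<close>

theorem differential_differential: "jacobi \<phi> \<Longrightarrow> differential (differential \<phi>) xs = 0"
proof (induction xs arbitrary: \<phi>)
  case (Cons x xs)
  show ?case
    using Cons.IH[OF jacobi_Cons[OF Cons.prems], of x] lie_derivative_differential[OF Cons.prems, of x xs]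
    by (simp add: differential_diff)
qed simp

lemma skew_lie_derivative: "skew \<phi> \<Longrightarrow> skew (lie_derivative x \<phi>)"
proof -
  have "lie_derivative x \<phi> (ws @ a # b # zs) = - lie_derivative x \<phi> (ws @ b # a # zs)"
    if "skew \<phi>" for \<phi> ws a b zs
    using that
  proof (induction ws arbitrary: \<phi>)
    case Nil
    have "(\<lambda>ws. \<phi> (a # b # ws)) = (\<lambda>ws. - \<phi> (b # a # ws))"
      using skewD[OF Nil, of "[]" a b] by (simp add: fun_eq_iff)
    \<comment> \<open>These exchanges match the bracket terms of \<open>a # b\<close> with those of
      \<open>b # a\<close>.\<close>
    moreover have "\<phi> (brk x b # a # zs) = - \<phi> (a # brk x b # zs)" "\<phi> (brk x a # b # zs) = - \<phi> (b # brk x a # zs)"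
      using skewD[OF Nil, of "[]" "brk x b" a zs] skewD[OF Nil, of "[]" "brk x a" b zs] by simp_all
    ultimately show ?case
      by (simp add: lie_derivative_uminus)
  next
    case (Cons w ws)
    show ?case
      using Cons.IH[OF skew_Cons[OF Cons.prems], of w] skewD[OF Cons.prems, of "brk x w # ws" a b zs] by simp
  qed
  then show "skew \<phi> \<Longrightarrow> skew (lie_derivative x \<phi>)"
    unfolding skew_def[of "lie_derivative x \<phi>"] by blast
qed

text \<open>On \<open>a # b # zs\<close> the two Lie derivative terms change places when
  \<open>a\<close> and \<open>b\<close> do, the double contraction changes sign by
  \<open>skew\<close>, and the remaining \<open>\<phi> (brk a b # zs)\<close> is what
  \<open>bracket_skew\<close> is for.\<close>

lemma skew_differential: "skew \<phi> \<Longrightarrow> bracket_skew \<phi> \<Longrightarrow> skew (differential \<phi>)"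
proof -
  have "differential \<phi> (ws @ a # b # zs) = - differential \<phi> (ws @ b # a # zs)"
    if "skew \<phi>" "bracket_skew \<phi>" for \<phi> ws a b zs
    using that
  proof (induction ws arbitrary: \<phi>)
    case Nil
    have "(\<lambda>ws. \<phi> (a # b # ws)) = (\<lambda>ws. - \<phi> (b # a # ws))"
      using skewD[OF Nil(1), of "[]" a b] by (simp add: fun_eq_iff)
    moreover have "\<phi> (brk a b # zs) = - \<phi> (brk b a # zs)"
      using Nil(2)[unfolded bracket_skew_def] by (metis append_Nil)
    ultimately show ?case
      by (simp add: differential_uminus)
  next
    case (Cons w ws)
    show ?case
      using Cons.IH[OF skew_Cons[OF Cons.prems(1)] bracket_skew_Cons[OF Cons.prems(2)], of w]
        skewD[OF skew_lie_derivative[OF Cons.prems(1), of w], of ws a b zs]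
      by simp
  qed
  then show "skew \<phi> \<Longrightarrow> bracket_skew \<phi> \<Longrightarrow> skew (differential \<phi>)"
    unfolding skew_def[of "differential \<phi>"] by blast
qed

text \<open>Skew-symmetry moves each bracket from its own place to the front, where the
  Chevalley-Eilenberg formula has it; the sign counts the entries passed.\<close>

lemma lie_derivative_eq:
  "skew \<phi> \<Longrightarrow> lie_derivative x \<phi> ys =
    op x (\<phi> ys) - (\<Sum>j<length ys. alternate j (\<phi> (brk x (ys ! j) # nths ys (- {j}))))"
proof (induction ys arbitrary: \<phi>)
  case (Cons y ys)
  \<comment> \<open>Index sets seen from the tail: deleting position 0 leaves all of it, deleting
    \<open>Suc i\<close> deletes its position \<open>i\<close>.\<close>
  have *: "{j. Suc j \<in> - {0}} = UNIV" "{j. Suc j \<in> - {Suc i}} = - {i}" "{j. j \<noteq> i} = - {i}" for i :: nat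
    by auto
  have "\<phi> (y # brk x (ys ! j) # zs) = - \<phi> (brk x (ys ! j) # y # zs)" for j zs
    using skewD[OF Cons.prems, of "[]" y "brk x (ys ! j)" zs] by simp
  then show ?case
    using Cons.IH[OF skew_Cons[OF Cons.prems], of y]
    by (simp add: sum.lessThan_Suc_shift nths_Cons * nths_all sum_negf del: sum.lessThan_Suc)
qed simp

text \<open>Actions on a value containing \<open>x\<close> share one sum with the brackets of
  \<open>x\<close>: this is the grouping in which the dependence on \<open>x\<close> is examined
  later.\<close>

lemma chevalley_eilenberg_Cons:
  "chevalley_eilenberg \<phi> (x # ys) = op x (\<phi> ys)
    - (\<Sum>j<length ys. alternate j (op (ys ! j) (\<phi> (x # nths ys (- {j}))) + \<phi> (brk x (ys ! j) # nths ys (- {j}))))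
    + (\<Sum>j<length ys. \<Sum>i<j. alternate (i + j) (\<phi> (brk (ys ! i) (ys ! j) # x # nths ys (- {i, j}))))"
proof -
  have *: "{j. Suc j \<in> - {0}} = UNIV" "{j. Suc j \<in> - {Suc i}} = - {i}"
    "{j. Suc j \<in> - {0, Suc i}} = - {i}" "{j. Suc j \<in> - {Suc i, Suc i'}} = - {i, i'}"
    "{j. j \<noteq> i} = - {i}" "{j. j \<noteq> i \<and> j \<noteq> i'} = - {i, i'}" for i i' :: nat
    by auto
  show ?thesis
    unfolding chevalley_eilenberg_def
    by (simp add: sum.lessThan_Suc_shift nths_Cons * nths_all sum_negf sum.distrib sum_subtractf del: sum.lessThan_Suc)
qed

text \<open>The action of \<open>x\<close> and its brackets form the Lie derivative; once
  \<open>x\<close> is moved back to the front, the rest is minus the formula for the contraction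
  with \<open>x\<close>.\<close>

lemma chevalley_eilenberg_eq:
  "skew \<phi> \<Longrightarrow> chevalley_eilenberg \<phi> xs = differential \<phi> xs"
proof (induction xs arbitrary: \<phi>)
  case Nil
  show ?case by (simp add: chevalley_eilenberg_def)
next
  case (Cons x xs)
  have "\<phi> (z # x # zs) = - \<phi> (x # z # zs)" for z zs
    using skewD[OF Cons.prems, of "[]" z x zs] by simp
  then show ?case
    using Cons.IH[OF skew_Cons[OF Cons.prems], of x, symmetric]
    by (simp add: chevalley_eilenberg_Cons lie_derivative_eq[OF Cons.prems] chevalley_eilenberg_def[of "\<lambda>ws. \<phi> (x # ws)"]
        sum.distrib sum_negf)
qed

end


section \<open>Modules over differential operators\<close>

context differential_algebra
begin

lemma char_0_space_scale: "char_0_space sA"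
  by (rule char_0_space.intro) (rule vector_space_axioms)

lemma der_add: "der (a + b) = der a + der b"
  and der_scale: "der (sA c a) = sA c (der a)"
  using linearD[OF der_linear] by auto

lemma der_zero [simp]: "der 0 = 0"
  by (rule additive_zero) (rule der_add)

lemma der_one [simp]: "der 1 = 0"
  using der_mult[of 1 1] by simp

lemma scale_one_mult: "sA c 1 * a = sA c a"
  using scale_mult[of c 1 a] by simp

lemma diffop_mult_const: "diffop_mult der [:a:] Q = smult a Q"
  by (simp add: diffop_mult_def)

lemma diffop_mult_der: "diffop_mult der [:0, 1:] Q = der_compose der Q"
  by (simp add: diffop_mult_def)

end

section \<open>Multiplication by A, derivation and scalars inside one action\<close>

context diffop_module
begin

abbreviation mult_by :: "'a \<Rightarrow> 'v \<Rightarrow> 'v" where "mult_by \<equiv> const_act act"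
abbreviation deriv :: "'v \<Rightarrow> 'v" where "deriv \<equiv> der_act act"
abbreviation scalar :: "'k \<Rightarrow> 'v \<Rightarrow> 'v" where "scalar \<equiv> scalar_act sA act"

lemma act_zero_left [simp]: "act 0 v = 0"
  by (rule additive_zero[of "\<lambda>P. act P v"]) (rule act_add_left)

lemma act_sum_left: "act (\<Sum>i\<in>I. P i) v = (\<Sum>i\<in>I. act (P i) v)"
  by (rule additive_sum[of "\<lambda>P. act P v"]) (rule act_add_left)

lemma mult_by_add_right: "mult_by a (v + w) = mult_by a v + mult_by a w"
  by (simp add: const_act_def act_add_right)

lemma mult_by_add_left: "mult_by (a + b) v = mult_by a v + mult_by b v"
  using act_add_left[of "[:a:]" "[:b:]"] by (simp add: const_act_def)

lemma mult_by_mult: "mult_by (a * b) v = mult_by a (mult_by b v)"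
  using act_mult[of "[:a:]" "[:b:]"] by (simp add: const_act_def diffop_mult_const)

lemma mult_by_one [simp]: "mult_by 1 v = v"
  by (simp add: const_act_def act_one flip: one_pCons)

lemma mult_by_zero_left [simp]: "mult_by 0 v = 0"
  by (simp add: const_act_def)

lemma mult_by_zero_right [simp]: "mult_by a 0 = 0"
  by (rule additive_zero) (rule mult_by_add_right)

lemma scalar_eq: "scalar c = mult_by (sA c 1)"
  by (simp add: scalar_act_def const_act_def fun_eq_iff)

lemma mult_by_scale: "mult_by (sA c a) v = scalar c (mult_by a v)"
  by (simp add: scalar_eq scale_one_mult flip: mult_by_mult)

lemma mult_by_scalar: "mult_by a (scalar c v) = scalar c (mult_by a v)"
  by (simp add: scalar_eq mult.commute flip: mult_by_mult)

lemma vector_space_scalar: "vector_space scalar"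
  by unfold_locales
    (simp_all add: scalar_eq mult_by_add_right scale_left_distrib mult_by_add_left scale_one_mult flip: mult_by_mult)

sublocale V: char_0_space scalar
  by (rule char_0_space.intro) (rule vector_space_scalar)

lemma linear_mult_by: "Vector_Spaces.linear scalar scalar (mult_by a)"
  by (simp add: Vector_Spaces.linear_iff vector_space_scalar mult_by_add_right mult_by_scalar)

lemma linear_mult_by_left: "Vector_Spaces.linear sA scalar (\<lambda>a. mult_by a v)"
  by (simp add: Vector_Spaces.linear_iff vector_space_scalar vector_space_axioms mult_by_add_left mult_by_scale)

lemma deriv_add: "deriv (v + w) = deriv v + deriv w"
  by (simp add: der_act_def act_add_right)

text \<open>The Leibniz rule of the module is the commutation of the derivation with an element of A
  in the algebra of operators.\<close>

lemma deriv_mult_by: "deriv (mult_by a v) = mult_by a (deriv v) + mult_by (der a) v"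
proof -
  have "deriv (mult_by a v) = act (der_compose der [:a:]) v"
    by (simp add: der_act_def const_act_def diffop_mult_der flip: act_mult)
  also have "der_compose der [:a:] = diffop_mult der [:a:] [:0, 1:] + [:der a:]"
    by (simp add: der_compose_def diffop_mult_const map_poly_pCons)
  also have "act \<dots> v = mult_by a (deriv v) + mult_by (der a) v"
    by (simp only: act_add_left act_mult) (simp add: der_act_def const_act_def)
  finally show ?thesis .
qed

lemma linear_deriv: "Vector_Spaces.linear scalar scalar deriv"
  by (simp add: Vector_Spaces.linear_iff vector_space_scalar deriv_add scalar_eq deriv_mult_by der_scale)

lemma act_eq: "act P v = (\<Sum>i\<le>degree P. mult_by (coeff P i) ((deriv ^^ i) v))"
proof -
  have pow: "act (monom 1 i) v = (deriv ^^ i) v" for i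
  proof (induction i)
    case 0
    show ?case by (simp add: act_one monom_0 flip: one_pCons)
  next
    case (Suc i)
    have "monom 1 (Suc i) = diffop_mult der [:0, 1:] (monom 1 i)"
      by (simp add: diffop_mult_der der_compose_def map_poly_monom monom_Suc)
    then show ?case
      by (simp add: act_mult Suc.IH) (simp add: der_act_def)
  qed
  have "act (monom a i) v = mult_by a ((deriv ^^ i) v)" for a i
    using act_mult[of "[:a:]" "monom 1 i" v]
    by (simp add: diffop_mult_const smult_monom pow) (simp add: const_act_def)
  then show ?thesis
    using act_sum_left[of "\<lambda>i. monom (coeff P i) i" "{..degree P}" v]
    by (simp add: poly_as_sum_of_monoms)
qed

section \<open>The substitution convention for polynomial functions\<close>

text \<open>In the notation of the paper, \<open>twist a f\<close> is f(x) (|_(x=D) a), and \<open>adjoint P l f\<close> is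
  (|_(x=D) P^*(l)) f(x); in the latter P^*(l) has been moved onto f, using that D on a is x on f.\<close>

definition twist :: "'a \<Rightarrow> ('k \<Rightarrow> 'v) \<Rightarrow> 'v"
  where "twist a f = subst_power scalar (\<lambda>n. mult_by ((der ^^ n) a)) f"

definition adjoint :: "'a poly \<Rightarrow> 'k \<Rightarrow> ('k \<Rightarrow> 'v) \<Rightarrow> 'v"
  where "adjoint P l f = (\<Sum>i\<le>degree P. twist (coeff P i) (\<lambda>t. scalar ((- l - t) ^ i) (f t)))"

lemma additive_terms_mult_by: "additive_terms (\<lambda>n. mult_by (a n))"
  by (simp add: additive_terms_def mult_by_add_right)

lemma twist_add: "poly_fun scalar f \<Longrightarrow> poly_fun scalar g \<Longrightarrow> twist a (\<lambda>t. f t + g t) = twist a f + twist a g"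
  unfolding twist_def by (rule V.subst_power_add[OF additive_terms_mult_by])

lemma twist_zero [simp]: "twist a (\<lambda>t. 0) = 0"
  unfolding twist_def by (subst V.subst_power_const[OF additive_terms_mult_by]) simp

lemma twist_scalar:
  assumes "poly_fun scalar f"
  shows "twist a (\<lambda>t. scalar c (f t)) = scalar c (twist a f)"
proof -
  have "twist a (\<lambda>t. scalar c (f t)) = subst_power scalar (\<lambda>n v. mult_by ((der ^^ n) a) (scalar c v)) f"
    unfolding twist_def by (rule V.subst_power_linear[OF V.linear_scale assms additive_terms_mult_by])
  also have "\<dots> = scalar c (twist a f)"
    unfolding twist_def mult_by_scalar
    by (rule V.subst_power_compose[symmetric, OF additive_terms_mult_by]) (rule V.scale_right_distrib)
  finally show ?thesis .
qed

lemma twist_uminus: "poly_fun scalar f \<Longrightarrow> twist a (\<lambda>t. - f t) = - twist a f"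
  using twist_scalar[of f a "- 1"] by simp

text \<open>The derivation on \<open>a\<close> is exchanged for multiplication by \<open>t\<close>
  on the other factor; \<open>twist_shift\<close> and \<open>twist_funpow\<close> iterate this
  exchange.\<close>

lemma twist_times: "poly_fun scalar f \<Longrightarrow> twist a (\<lambda>t. scalar t (f t)) = twist (der a) f"
  unfolding twist_def
  by (subst V.subst_power_times[OF additive_terms_mult_by]) (simp_all add: funpow_swap1)

lemma der_funpow_add: "(der ^^ n) (a + b) = (der ^^ n) a + (der ^^ n) b"
  by (induction n) (simp_all add: der_add)

lemma der_funpow_scale: "(der ^^ n) (sA c a) = sA c ((der ^^ n) a)"
  by (induction n) (simp_all add: der_scale)

lemma twist_add_left: "twist (a + b) f = twist a f + twist b f"
  by (simp add: twist_def subst_power_def term_sum_def der_funpow_add mult_by_add_left sum.distrib)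

lemma twist_zero_left [simp]: "twist 0 f = 0"
  by (rule additive_zero[of "\<lambda>a. twist a f"]) (rule twist_add_left)

lemma twist_sum_left: "twist (\<Sum>i\<in>I. a i) f = (\<Sum>i\<in>I. twist (a i) f)"
  by (rule additive_sum[of "\<lambda>a. twist a f"]) (rule twist_add_left)

lemma twist_uminus_left: "twist (- a) f = - twist a f"
  by (rule additive_uminus[of "\<lambda>a. twist a f"]) (rule twist_add_left)

lemma twist_scale_left: "twist (sA c a) f = scalar c (twist a f)"
  by (simp add: twist_def subst_power_def term_sum_def der_funpow_scale mult_by_scale V.scale_sum_right)

lemma twist_one: 
  assumes "poly_fun scalar f"
  shows "twist 1 f = f 0"
proof -
  have "(der ^^ n) 1 = (if n = 0 then 1 else 0)" for n
    by (induction n) auto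
  \<comment> \<open>Derivatives of 1 vanish, so with \<open>0 ^ 0 = 1\<close> this is substitution
    of the scalar 0.\<close>
  then have "mult_by ((der ^^ n) 1) v = scalar (0 ^ n) v" for n v
    by (cases n) (simp_all only: mult_by_one, simp_all)
  then have "(\<lambda>n. mult_by ((der ^^ n) 1)) = (\<lambda>n. scalar (0 ^ n))"
    by (simp add: fun_eq_iff)
  then have "twist 1 f = subst_power scalar (\<lambda>n v. scalar (0 ^ n) v) f"
    by (simp add: twist_def)
  also have "\<dots> = f 0"
    by (rule V.subst_power_eval[where g = "\<lambda>v. v", OF _ assms])
       (simp add: Vector_Spaces.linear_iff vector_space_scalar)
  finally show ?thesis .
qed

text \<open>A translation by \<open>c\<close> turns the substituted derivation into
  \<open>der + c\<close>. This is the operator that appears when an anchor value is moved past the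
  derivation in \<open>anchor_at_der_funpow\<close>.\<close>

lemma twist_shift:
  assumes "poly_fun scalar f"
  shows "twist a (\<lambda>t. f (c + t)) = subst_power scalar (\<lambda>n. mult_by (((\<lambda>b. der b + sA c b) ^^ n) a)) f"
  using assms
proof (induction rule: V.poly_fun_induct)
  case (power n v)
  have "twist a (\<lambda>t. scalar ((c + t) ^ n) v) = mult_by (((\<lambda>b. der b + sA c b) ^^ n) a) v"
  proof (induction n arbitrary: a)
    case 0
    show ?case
      using V.subst_power_const[OF additive_terms_mult_by[of "\<lambda>n. (der ^^ n) a"], of v]
      by (simp add: twist_def)
  next
    case (Suc n)
    have pf: "poly_fun scalar (\<lambda>t. scalar ((c + t) ^ n) v)"
      using V.poly_fun_shift[OF V.poly_fun_power] .
    have "twist a (\<lambda>t. scalar ((c + t) ^ Suc n) v)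
      = twist a (\<lambda>t. scalar c (scalar ((c + t) ^ n) v) + scalar t (scalar ((c + t) ^ n) v))"
      by (simp add: V.scale_left_distrib distrib_right)
    also have "\<dots> = twist (der a + sA c a) (\<lambda>t. scalar ((c + t) ^ n) v)"
      by (simp only: twist_add[OF V.poly_fun_scale[OF pf] V.poly_fun_times[OF pf]] twist_scalar[OF pf]
          twist_times[OF pf] twist_add_left twist_scale_left) (rule add.commute)
    also have "\<dots> = mult_by (((\<lambda>b. der b + sA c b) ^^ Suc n) a) v"
      by (simp only: Suc.IH funpow_Suc_right comp_apply)
    finally show ?case .
  qed
  then show ?case
    by (simp only: V.subst_power_power[OF additive_terms_mult_by])
next
  case (add f g)
  then show ?case
    using twist_add[OF V.poly_fun_shift[OF add(1)] V.poly_fun_shift[OF add(2)]]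
      V.subst_power_add[OF additive_terms_mult_by add(1,2)]
    by simp
qed

lemma poly_fun_minus_times_power:
  "poly_fun scalar f \<Longrightarrow> poly_fun scalar (\<lambda>t. scalar ((- l - t) ^ i) (f t))"
proof (induction i)
  case (Suc i)
  note pf = Suc.IH[OF Suc.prems]
  have "(\<lambda>t. scalar ((- l - t) ^ Suc i) (f t))
    = (\<lambda>t. scalar (- l) (scalar ((- l - t) ^ i) (f t)) + scalar (- 1) (scalar t (scalar ((- l - t) ^ i) (f t))))"
    by (simp add: fun_eq_iff V.scale_left_diff_distrib left_diff_distrib)
  then show ?case
    using V.poly_fun_add[OF V.poly_fun_scale[OF pf, of "- l"] V.poly_fun_scale[OF V.poly_fun_times[OF pf], of "- 1"]]
    by simp
qed simp

text \<open>An adjoint symbol applies powers of -lambda - der to \<open>a\<close>; exchanging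
  \<open>der\<close> for \<open>t\<close> yields the factor in \<open>adjoint\<close>.\<close>

lemma twist_funpow:
  assumes "poly_fun scalar f"
  shows "twist (((\<lambda>a. - sA l a - der a) ^^ i) a) f = twist a (\<lambda>t. scalar ((- l - t) ^ i) (f t))"
proof (induction i arbitrary: a)
  case (Suc i)
  note pf = poly_fun_minus_times_power[OF assms, of l i]
  have "twist (((\<lambda>a. - sA l a - der a) ^^ Suc i) a) f
    = twist (- sA l a + - der a) (\<lambda>t. scalar ((- l - t) ^ i) (f t))"
    by (simp only: funpow_Suc_right comp_apply Suc.IH) simp
  also have "\<dots> = twist a (\<lambda>t. scalar (- l) (scalar ((- l - t) ^ i) (f t))
      + scalar (- 1) (scalar t (scalar ((- l - t) ^ i) (f t))))"
    by (simp only: twist_add_left twist_uminus_left twist_scale_left twist_scalar[OF pf]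
        twist_scalar[OF V.poly_fun_times[OF pf]] twist_times[OF pf]
        twist_add[OF V.poly_fun_scale[OF pf] V.poly_fun_scale[OF V.poly_fun_times[OF pf]]]) simp
  also have "\<dots> = twist a (\<lambda>t. scalar ((- l - t) ^ Suc i) (f t))"
    by (simp add: V.scale_left_diff_distrib left_diff_distrib)
  finally show ?case .
qed simp

lemma evaluate_adjoint_symbol:
  "evaluate sA \<rho> (adjoint_symbol der P j) = (\<Sum>i\<le>degree P. ((\<lambda>a. - sA (\<rho> (Lam j)) a - der a) ^^ i) (coeff P i))"
proof -
  interpret A: char_0_space sA by (rule char_0_space_scale)
  have "evaluate sA \<rho> (((\<lambda>F. - var_mult (Lam j) F - Poly_Mapping.map der F) ^^ i) (Poly_Mapping.single 0 a))
    = ((\<lambda>a. - sA (\<rho> (Lam j)) a - der a) ^^ i) a" for i a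
    by (induction i) (simp_all add: A.evaluate_diff A.evaluate_uminus A.evaluate_var_mult A.evaluate_map[OF der_linear])
  then show ?thesis
    by (simp add: adjoint_symbol_def A.evaluate_sum)
qed

text \<open>A sesquilinearity factor becomes a functional applied to the dependence on
  \<open>X j\<close>, the other indeterminates being fixed, so nested factors can be peeled off one
  at a time.\<close>

lemma evaluate_adjoint_apply:
  "evaluate scalar \<rho> (adjoint_apply der mult_by j P F)
    = adjoint P (\<rho> (Lam j)) (\<lambda>t. evaluate scalar (\<rho>(X j := t)) F)"
proof -
  have "evaluate scalar \<rho> (adjoint_apply der mult_by j P F)
    = twist (evaluate sA \<rho> (adjoint_symbol der P j)) (\<lambda>t. evaluate scalar (\<rho>(X j := t)) F)"
    unfolding adjoint_apply_def twist_def
    by (rule V.evaluate_subst_factor) (rule linear_mult_by linear_mult_by_left der_linear)+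
  then show ?thesis
    by (simp add: adjoint_def evaluate_adjoint_symbol twist_sum_left twist_funpow[OF V.poly_fun_evaluate])
qed

lemma adjoint_const: "adjoint [:a:] l f = twist a f"
  by (simp add: adjoint_def)

lemma adjoint_one: "poly_fun scalar f \<Longrightarrow> adjoint 1 l f = f 0"
  by (simp add: one_pCons adjoint_const twist_one)

lemma adjoint_der: "poly_fun scalar f \<Longrightarrow> adjoint [:0, 1:] l f = - scalar l (f 0)"
  using poly_fun_minus_times_power[of f l 1]
  by (simp add: adjoint_def twist_one)

end


section \<open>Pointwise form of the axioms\<close>

lemma (in char_0_space) evaluate_diagonal:
  "F \<in> lam_polys 1 \<Longrightarrow> evaluate s \<rho> F = evaluate s (\<lambda>_. \<rho> (Lam 0)) F"
  by (erule evaluate_cong) simp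

lemma (in char_0_space) evaluate_at_single:
  "F \<in> lam_polys 1 \<Longrightarrow> evaluate s \<rho> (at_poly s [q] F) = evaluate s (\<lambda>_. scalar_value \<rho> q) F"
  by (subst evaluate_at_poly) (simp_all, rule evaluate_cong[of F 1], simp_all add: point_def)

text \<open>Without positive powers of \<open>x\<close> no derivation falls on \<open>F\<close>.
  Applied to constant operators, this extracts the Leibniz rules over A from the axioms for general
  operators.\<close>

lemma (in diffop_module) evaluate_subst_factor_const:
  assumes "\<And>t. evaluate sA (\<rho>(x := t)) Q = a"
  shows "evaluate scalar \<rho> (subst_factor mult_by x deriv Q F) = mult_by a (evaluate scalar \<rho> F)"
proof -
  interpret A: char_0_space sA by (rule char_0_space_scale)
  have "additive_terms (\<lambda>n q. mult_by q ((deriv ^^ n) (evaluate scalar \<rho> F)))"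
    by (simp add: additive_terms_def mult_by_add_left)
  then show ?thesis
    by (subst A.evaluate_subst_factor[OF linear_mult_by_left linear_mult_by linear_deriv])
       (simp add: assms A.subst_power_const)
qed

lemma symbol_const: 
  assumes "vector_space sA"
  shows "symbol sA [:a:] q = Poly_Mapping.single 0 a"
proof -
  interpret vector_space sA by fact
  have "poly_times_vec sA 1 a = Poly_Mapping.single 0 a"
    by (rule poly_mapping_eqI) (simp add: poly_times_vec_def lookup_map lookup_one lookup_single when_def)
  then show ?thesis
    by (simp add: symbol_def)
qed

section \<open>Bracket, action and anchor at scalar values of lambda\<close>

context lie_conformal_algebroid_module
begin

interpretation A: char_0_space sA
  by (rule E.char_0_space_scale)

text \<open>The Lie conformal algebra axioms speak of the restriction to operators with constant
  coefficients; its scalars and derivation have to be identified with those of the full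
  module.\<close>

lemma const_act_restriction: "const_act (\<lambda>p. actE (map_poly (\<lambda>c. sA c 1) p)) = E.scalar"
  by (simp add: fun_eq_iff const_act_def scalar_act_def map_poly_pCons)

lemma der_act_restriction: "der_act (\<lambda>p. actE (map_poly (\<lambda>c. sA c 1) p)) = E.deriv"
  by (simp add: fun_eq_iff der_act_def map_poly_pCons)

lemmas br_linear_left = L.br_linear_left[unfolded const_act_restriction]
  and br_linear_right = L.br_linear_right[unfolded const_act_restriction]
  and br_der_right = L.br_der_right[unfolded der_act_restriction]
  and br_skew = L.br_skew[unfolded const_act_restriction der_act_restriction]
  and br_jacobi = L.br_jacobi[unfolded const_act_restriction]

text \<open>Giving every indeterminate the value \<open>l\<close> is harmless because a bracket
  involves only \<open>Lam 0\<close>, and it gives one normal form for all substitutions of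
  lambda.\<close>

definition bracket_at :: "'e \<Rightarrow> 'k \<Rightarrow> 'e \<Rightarrow> 'e"
  where "bracket_at u l v = evaluate E.scalar (\<lambda>_. l) (br u v)"

definition action_at :: "'e \<Rightarrow> 'k \<Rightarrow> 'm \<Rightarrow> 'm"
  where "action_at u l m = evaluate M.scalar (\<lambda>_. l) (lact u m)"

definition anchor_at :: "'e \<Rightarrow> 'k \<Rightarrow> 'a \<Rightarrow> 'a"
  where "anchor_at u l a = evaluate sA (\<lambda>_. l) (\<theta> u a)"

lemma evaluate_br: "evaluate E.scalar \<rho> (br u v) = bracket_at u (\<rho> (Lam 0)) v"
  unfolding bracket_at_def by (rule E.V.evaluate_diagonal) (rule L.br_poly)

lemma evaluate_br_at: "evaluate E.scalar \<rho> (at_poly E.scalar [q] (br u v)) = bracket_at u (scalar_value \<rho> q) v"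
  unfolding bracket_at_def by (rule E.V.evaluate_at_single) (rule L.br_poly)

lemma evaluate_lact: "evaluate M.scalar \<rho> (lact u m) = action_at u (\<rho> (Lam 0)) m"
  unfolding action_at_def by (rule M.V.evaluate_diagonal) (rule lact_poly)

lemma evaluate_lact_at: "evaluate M.scalar \<rho> (at_poly M.scalar [q] (lact u m)) = action_at u (scalar_value \<rho> q) m"
  unfolding action_at_def by (rule M.V.evaluate_at_single) (rule lact_poly)

lemma anchor_poly: "\<theta> u a \<in> lam_polys 1"
  and anchor_linear: "Vector_Spaces.linear sA (coeff_scale sA) (\<theta> u)"
  and anchor_der: "\<theta> u (der a) = Poly_Mapping.map der (\<theta> u a) + var_mult (Lam 0) (\<theta> u a)"
  using anchor_CDer[of u] by (auto simp: CDer_def)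

lemma evaluate_anchor: "evaluate sA \<rho> (\<theta> u a) = anchor_at u (\<rho> (Lam 0)) a"
  unfolding anchor_at_def by (rule A.evaluate_diagonal) (rule anchor_poly)

lemma bracket_at_linear_left: "Vector_Spaces.linear E.scalar E.scalar (\<lambda>u. bracket_at u l v)"
  by (simp add: Vector_Spaces.linear_iff E.vector_space_scalar bracket_at_def linearD[OF br_linear_left]
      E.V.evaluate_add E.V.evaluate_coeff_scale)

lemma bracket_at_linear_right: "Vector_Spaces.linear E.scalar E.scalar (bracket_at u l)"
  by (simp add: Vector_Spaces.linear_iff E.vector_space_scalar bracket_at_def linearD[OF br_linear_right]
      E.V.evaluate_add E.V.evaluate_coeff_scale)

lemma action_at_linear_left: "Vector_Spaces.linear E.scalar M.scalar (\<lambda>u. action_at u l m)"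
  by (simp add: Vector_Spaces.linear_iff E.vector_space_scalar M.vector_space_scalar action_at_def
      linearD[OF lact_linear_left] M.V.evaluate_add M.V.evaluate_coeff_scale)

lemma action_at_linear_right: "Vector_Spaces.linear M.scalar M.scalar (action_at u l)"
  by (simp add: Vector_Spaces.linear_iff M.vector_space_scalar action_at_def
      linearD[OF lact_linear_right] M.V.evaluate_add M.V.evaluate_coeff_scale)

lemma anchor_at_linear: "Vector_Spaces.linear sA sA (anchor_at u l)"
  by (simp add: Vector_Spaces.linear_iff E.vector_space_axioms anchor_at_def
      linearD[OF anchor_linear] A.evaluate_add A.evaluate_coeff_scale)

lemma anchor_at_der: "anchor_at u l (der a) = der (anchor_at u l a) + sA l (anchor_at u l a)"
  by (simp add: anchor_at_def anchor_der A.evaluate_add A.evaluate_map[OF E.der_linear] A.evaluate_var_mult)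

lemma anchor_at_der_funpow: "anchor_at u l ((der ^^ n) a) = ((\<lambda>b. der b + sA l b) ^^ n) (anchor_at u l a)"
  by (induction n) (simp_all add: anchor_at_der)

lemma bracket_at_deriv: "bracket_at u l (E.deriv v) = E.deriv (bracket_at u l v) + E.scalar l (bracket_at u l v)"
  by (simp add: bracket_at_def br_der_right E.V.evaluate_add E.V.evaluate_map[OF E.linear_deriv]
      E.V.evaluate_var_mult)

lemma evaluate_anchor_symbol: "evaluate sA \<rho> (lin_ext (\<theta> u) (Poly_Mapping.single 0 a)) = anchor_at u (\<rho> (Lam 0)) a"
proof -
  have "Vector_Spaces.linear sA sA (\<lambda>a. evaluate sA \<rho> (\<theta> u a))"
    using anchor_at_linear by (simp add: evaluate_anchor)
  then show ?thesis
    by (simp add: A.evaluate_lin_ext evaluate_anchor)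
qed

lemma bracket_at_mult_by:
  "bracket_at u l (E.mult_by a v) = E.mult_by a (bracket_at u l v) + E.mult_by (anchor_at u l a) v"
  unfolding bracket_at_def const_act_def[of actE a] br_act_right E.V.evaluate_add
  by (subst (1 2) E.evaluate_subst_factor_const)
     (simp_all add: symbol_const[OF E.vector_space_axioms] evaluate_anchor_symbol const_act_def)

lemma action_at_mult_by:
  "action_at u l (M.mult_by a m) = M.mult_by a (action_at u l m) + M.mult_by (anchor_at u l a) m"
  unfolding action_at_def const_act_def[of actM a] lact_act_right M.V.evaluate_add
  by (subst (1 2) M.evaluate_subst_factor_const)
     (simp_all add: symbol_const[OF E.vector_space_axioms] evaluate_anchor_symbol const_act_def)

lemma bracket_at_skew:
  "bracket_at v l u = - subst_power E.scalar (\<lambda>n. E.deriv ^^ n) (\<lambda>t. bracket_at u (- l - t) v)"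
  unfolding bracket_at_def[of v] br_skew[of v u] E.V.evaluate_uminus
    E.V.evaluate_subst_inside[OF E.linear_deriv] evaluate_br_at
  by (simp add: scalar_value_simps)

lemma bracket_at_jacobi:
  "bracket_at u l (bracket_at v m w) - bracket_at v m (bracket_at u l w) = bracket_at (bracket_at u l v) (l + m) w"
proof -
  define \<rho> where "\<rho> = point [l, m]"
  have \<rho>: "\<rho> (Lam 0) = l" "\<rho> (Lam (Suc 0)) = m"
    by (simp_all add: \<rho>_def point_def)
  show ?thesis
    using arg_cong[OF br_jacobi[of u v w], of "evaluate E.scalar \<rho>"]
    by (simp add: E.V.evaluate_diff E.V.evaluate_lin_ext evaluate_br_at bracket_at_linear_right
        bracket_at_linear_left \<rho> scalar_value_simps)
qed

lemma action_at_bracket: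
  "action_at (bracket_at u l v) (l + m) w = action_at u l (action_at v m w) - action_at v m (action_at u l w)"
proof -
  \<comment> \<open>The module axiom names the total value and subtracts the first, so the second
    lambda has to be \<open>l + m\<close>.\<close>
  define \<rho> where "\<rho> = point [l, l + m]"
  have \<rho>: "\<rho> (Lam 0) = l" "\<rho> (Lam (Suc 0)) = l + m"
    by (simp_all add: \<rho>_def point_def)
  show ?thesis
    using arg_cong[OF lact_br[of w u v], of "evaluate M.scalar \<rho>"]
    by (simp add: M.V.evaluate_diff M.V.evaluate_lin_ext E.V.evaluate_lin_ext evaluate_br_at evaluate_lact_at
        action_at_linear_right action_at_linear_left \<rho> scalar_value_simps)
qed

lemma poly_fun_action_at: "poly_fun M.scalar (\<lambda>l. action_at u l m)"
  using M.V.poly_fun_evaluate[of "\<lambda>_. 0" "Lam 0" "lact u m"] by (simp add: evaluate_lact)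

lemma poly_fun_bracket_at: "poly_fun E.scalar (\<lambda>l. bracket_at u l v)"
  using E.V.poly_fun_evaluate[of "\<lambda>_. 0" "Lam 0" "br u v"] by (simp add: evaluate_br)

lemma action_at_act: "action_at (actE P u) l m = M.adjoint P l (\<lambda>t. action_at u (l + t) m)"
  unfolding action_at_def[of "actE P u"] lact_act_left M.evaluate_adjoint_apply evaluate_lact_at
  by (simp add: scalar_value_simps)

end


section \<open>Cochains as functions of points\<close>

context lie_conformal_algebroid_module
begin

text \<open>A pair (u, l) stands for u together with the value l of the lambda in its slot.\<close>

definition bracket :: "'e \<times> 'k \<Rightarrow> 'e \<times> 'k \<Rightarrow> 'e \<times> 'k"
  where "bracket x y = (bracket_at (fst x) (snd x) (fst y), snd x + snd y)"

definition action :: "'e \<times> 'k \<Rightarrow> 'm \<Rightarrow> 'm"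
  where "action x = action_at (fst x) (snd x)"

sublocale leibniz: leibniz_module bracket action
  by unfold_locales
    (simp_all add: bracket_def action_def linearD[OF action_at_linear_right] action_at_bracket)

text \<open>Compatibility is demanded only for generators, the derivation and the elements of A;
  \<open>sesquilinear_act\<close> restores general operators. Polynomiality in \<open>l\<close>
  gives \<open>twist\<close> its meaning.\<close>

definition sesquilinear :: "('e \<times> 'k \<Rightarrow> 'm) \<Rightarrow> bool"
  where "sesquilinear f \<longleftrightarrow>
    (\<forall>l. Vector_Spaces.linear E.scalar M.scalar (\<lambda>u. f (u, l))) \<and>
    (\<forall>u. poly_fun M.scalar (\<lambda>l. f (u, l))) \<and>
    (\<forall>u l. f (E.deriv u, l) = - M.scalar l (f (u, l))) \<and>
    (\<forall>a u l. f (E.mult_by a u, l) = M.twist a (\<lambda>t. f (u, l + t)))"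

definition cochain :: "(('e \<times> 'k) list \<Rightarrow> 'm) \<Rightarrow> bool"
  where "cochain \<Phi> \<longleftrightarrow> skew \<Phi> \<and> (\<forall>ws zs. sesquilinear (\<lambda>x. \<Phi> (ws @ x # zs)))"

lemma sesquilinearI:
  assumes "\<And>u v l. f (u + v, l) = f (u, l) + f (v, l)"
    and "\<And>c u l. f (E.scalar c u, l) = M.scalar c (f (u, l))"
    and "\<And>u. poly_fun M.scalar (\<lambda>l. f (u, l))"
    and "\<And>u l. f (E.deriv u, l) = - M.scalar l (f (u, l))"
    and "\<And>a u l. f (E.mult_by a u, l) = M.twist a (\<lambda>t. f (u, l + t))"
  shows "sesquilinear f"
  using assms by (simp add: sesquilinear_def Vector_Spaces.linear_iff E.vector_space_scalar M.vector_space_scalar)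

lemma sesquilinearD:
  assumes "sesquilinear f"
  shows "Vector_Spaces.linear E.scalar M.scalar (\<lambda>u. f (u, l))"
    and "f (u + v, l) = f (u, l) + f (v, l)"
    and "f (E.scalar c u, l) = M.scalar c (f (u, l))"
    and "poly_fun M.scalar (\<lambda>l. f (u, l))"
    and "poly_fun M.scalar (\<lambda>t. f (u, l + t))"
    and "f (E.deriv u, l) = - M.scalar l (f (u, l))"
    and "f (E.mult_by a u, l) = M.twist a (\<lambda>t. f (u, l + t))"
  using assms M.V.poly_fun_shift[of "\<lambda>l. f (u, l)" l] by (simp_all add: sesquilinear_def Vector_Spaces.linear_iff)

lemma sesquilinear_zero: "sesquilinear (\<lambda>x. 0)"
  by (rule sesquilinearI) (simp_all add: M.V.poly_fun_const)

lemma sesquilinear_add: "sesquilinear f \<Longrightarrow> sesquilinear g \<Longrightarrow> sesquilinear (\<lambda>x. f x + g x)"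
  by (rule sesquilinearI) (simp_all add: sesquilinearD M.V.scale_right_distrib M.V.poly_fun_add M.twist_add)

lemma sesquilinear_scalar: "sesquilinear f \<Longrightarrow> sesquilinear (\<lambda>x. M.scalar c (f x))"
  by (rule sesquilinearI)
    (simp_all add: sesquilinearD M.V.scale_right_distrib M.V.poly_fun_scale M.twist_scalar mult.commute)

lemma sesquilinear_uminus: "sesquilinear f \<Longrightarrow> sesquilinear (\<lambda>x. - f x)"
  using sesquilinear_scalar[of f "- 1"] by simp

lemma sesquilinear_diff: "sesquilinear f \<Longrightarrow> sesquilinear g \<Longrightarrow> sesquilinear (\<lambda>x. f x - g x)"
  using sesquilinear_add[of f "\<lambda>x. - g x"] sesquilinear_uminus[of g] by simp

lemma sesquilinear_sum: "(\<And>i. i \<in> I \<Longrightarrow> sesquilinear (f i)) \<Longrightarrow> sesquilinear (\<lambda>x. \<Sum>i\<in>I. f i x)"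
  by (induction I rule: infinite_finite_induct) (simp_all add: sesquilinear_zero sesquilinear_add)

lemma sesquilinear_alternate: "sesquilinear f \<Longrightarrow> sesquilinear (\<lambda>x. alternate n (f x))"
  by (cases "even n") (simp_all add: alternate_def sesquilinear_uminus)

lemma sesquilinear_deriv_funpow:
  "sesquilinear f \<Longrightarrow> f ((E.deriv ^^ n) u, l) = M.scalar ((- l) ^ n) (f (u, l))"
  by (induction n) (simp_all add: sesquilinearD(6))

lemma sesquilinear_act:
  assumes "sesquilinear f"
  shows "f (actE P u, l) = M.adjoint P l (\<lambda>t. f (u, l + t))"
proof -
  have "f (actE P u, l) = (\<Sum>i\<le>degree P. f (E.mult_by (coeff P i) ((E.deriv ^^ i) u), l))"
    unfolding E.act_eq[of P u]
    by (rule additive_sum[of "\<lambda>u. f (u, l)"]) (rule sesquilinearD(2)[OF assms])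
  then show ?thesis
    by (simp only: sesquilinearD(7)[OF assms] sesquilinear_deriv_funpow[OF assms] M.adjoint_def minus_add_distrib diff_conv_add_uminus)
qed

lemma sesquilinear_ofI:
  assumes "\<And>l. Vector_Spaces.linear E.scalar M.scalar (\<lambda>u. f (u, l))"
    and "\<And>u. poly_fun M.scalar (\<lambda>l. f (u, l))"
    and "\<And>P u l. f (actE P u, l) = M.adjoint P l (\<lambda>t. f (u, l + t))"
  shows "sesquilinear f"
proof (rule sesquilinearI)
  fix u l a
  have pf: "poly_fun M.scalar (\<lambda>t. f (u, l + t))"
    by (rule M.V.poly_fun_shift) (rule assms)
  show "f (E.deriv u, l) = - M.scalar l (f (u, l))"
    using assms(3)[of "[:0, 1:]" u l] by (simp add: M.adjoint_der[OF pf]) (simp add: der_act_def)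
  show "f (E.mult_by a u, l) = M.twist a (\<lambda>t. f (u, l + t))"
    using assms(3)[of "[:a:]" u l] by (simp add: M.adjoint_const const_act_def)
qed (use assms(2) linearD[OF assms(1)] in auto)

lemma sesquilinear_action: "sesquilinear (\<lambda>x. action x m)"
  by (rule sesquilinear_ofI)
     (simp_all add: action_def action_at_linear_left poly_fun_action_at action_at_act)

text \<open>Neither term is sesquilinear alone: the anchor terms of the two cancel.\<close>

lemma sesquilinear_action_diff_bracket:
  assumes "sesquilinear f"
  shows "sesquilinear (\<lambda>x. action y (f x) - f (bracket y x))"
proof (rule sesquilinearI)
  note lin = linearD(3,4)[OF action_at_linear_right] linearD(3,4)[OF bracket_at_linear_right]
    sesquilinearD(2,3)[OF assms]
  obtain v m where y: "y = (v, m)" by fastforce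
  show "action y (f (u + w, l)) - f (bracket y (u + w, l)) =
      action y (f (u, l)) - f (bracket y (u, l)) + (action y (f (w, l)) - f (bracket y (w, l)))" for u w l
    by (simp add: action_def bracket_def lin)
  show "action y (f (E.scalar c u, l)) - f (bracket y (E.scalar c u, l))
      = M.scalar c (action y (f (u, l)) - f (bracket y (u, l)))" for c u l
    by (simp add: action_def bracket_def lin M.V.scale_right_diff_distrib)
  have pf: "poly_fun M.scalar (\<lambda>l. action_at v m (f (u, l)))" for u
    by (rule M.V.poly_fun_linear[OF action_at_linear_right sesquilinearD(4)[OF assms]])
  show "poly_fun M.scalar (\<lambda>l. action y (f (u, l)) - f (bracket y (u, l)))" for u
    using M.V.poly_fun_add[OF pf M.V.poly_fun_scale[OF sesquilinearD(5)[OF assms], of "- 1"]]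
    by (simp add: y action_def bracket_def)
  \<comment> \<open>The bracket contributes the derivation plus \<open>m\<close> at total value
    \<open>m + l\<close>, hence the factor \<open>- (m + l) + m = - l\<close>, the same as in the
    other term.\<close>
  show "action y (f (E.deriv u, l)) - f (bracket y (E.deriv u, l))
      = - M.scalar l (action y (f (u, l)) - f (bracket y (u, l)))" for u l
    using linearD(4)[OF action_at_linear_right, of v m "- l" "f (u, l)"]
    by (simp add: y action_def bracket_def bracket_at_deriv lin sesquilinearD(6)[OF assms]
        M.V.scale_left_distrib M.V.scale_right_diff_distrib)
  show "action y (f (E.mult_by a u, l)) - f (bracket y (E.mult_by a u, l))
      = M.twist a (\<lambda>t. action y (f (u, l + t)) - f (bracket y (u, l + t)))" for a u l
  proof -
    let ?F = "\<lambda>t. f (u, l + t)"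
    have pfF: "poly_fun M.scalar ?F" by (rule sesquilinearD(5)[OF assms])
    have "action_at v m (M.twist a ?F)
      = subst_power M.scalar (\<lambda>n w. action_at v m (M.mult_by ((der ^^ n) a) w)) ?F"
      unfolding M.twist_def
      by (rule M.V.subst_power_compose[OF M.additive_terms_mult_by]) (rule lin)
    \<comment> \<open>The action is a derivation over A, so each \<open>(der ^^ n) a\<close> yields
      a second term with the anchor. There the derivation has become \<open>der + m\<close>, which
      \<open>twist_shift\<close> reads as a translation by \<open>m\<close>.\<close>
    also have "\<dots> = subst_power M.scalar (\<lambda>n w. M.mult_by ((der ^^ n) a) (action_at v m w)) ?F
      + subst_power M.scalar (\<lambda>n. M.mult_by (((\<lambda>b. der b + sA m b) ^^ n) (anchor_at v m a))) ?F"
      by (simp add: action_at_mult_by anchor_at_der_funpow subst_power_def term_sum_def sum.distrib)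
    also have "\<dots> = M.twist a (\<lambda>t. action_at v m (?F t)) + M.twist (anchor_at v m a) (\<lambda>t. ?F (m + t))"
      unfolding M.twist_shift[OF pfF] M.twist_def
      by (simp add: M.V.subst_power_linear[OF action_at_linear_right pfF M.additive_terms_mult_by])
    finally have 1: "action_at v m (f (E.mult_by a u, l))
      = M.twist a (\<lambda>t. action_at v m (?F t)) + M.twist (anchor_at v m a) (\<lambda>t. ?F (m + t))"
      by (simp add: sesquilinearD(7)[OF assms])
    \<comment> \<open>The translation by \<open>m\<close> occurs here because the bracket already
      sits at the value \<open>m + l\<close>; so both anchor terms are the same expression.\<close>
    have 2: "f (bracket_at v m (E.mult_by a u), m + l)
      = M.twist a (\<lambda>t. f (bracket_at v m u, m + l + t)) + M.twist (anchor_at v m a) (\<lambda>t. ?F (m + t))"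
      by (simp add: bracket_at_mult_by lin sesquilinearD(7)[OF assms] ac_simps)
    have pf1: "poly_fun M.scalar (\<lambda>t. action_at v m (?F t))"
      by (rule M.V.poly_fun_linear[OF action_at_linear_right pfF])
    have pf2: "poly_fun M.scalar (\<lambda>t. f (bracket_at v m u, m + l + t))"
      by (rule sesquilinearD(5)[OF assms])
    have "M.twist a (\<lambda>t. action_at v m (?F t) + - f (bracket_at v m u, m + l + t))
      = M.twist a (\<lambda>t. action_at v m (?F t)) + - M.twist a (\<lambda>t. f (bracket_at v m u, m + l + t))"
      using M.twist_add[OF pf1 M.V.poly_fun_scale[OF pf2, of "- 1"], of a] M.twist_uminus[OF pf2, of a] by simp
    then show ?thesis
      using 1 2 by (simp add: y action_def bracket_def add.assoc)
  qed
qed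

section \<open>Cochains on lists of pairs and their differential\<close>

lemma cochainD:
  assumes "cochain \<Phi>"
  shows "skew \<Phi>" "sesquilinear (\<lambda>x. \<Phi> (ws @ x # zs))" "sesquilinear (\<lambda>x. \<Phi> (x # zs))"
    "sesquilinear (\<lambda>x. \<Phi> (w # x # zs))"
  using assms spec[of "\<lambda>ws. \<forall>zs. sesquilinear (\<lambda>x. \<Phi> (ws @ x # zs))" "[]"]
    spec[of "\<lambda>ws. \<forall>zs. sesquilinear (\<lambda>x. \<Phi> (ws @ x # zs))" "[w]"]
  by (auto simp: cochain_def)

lemma cochainI:
  assumes "skew \<Phi>" "\<And>zs. sesquilinear (\<lambda>x. \<Phi> (x # zs))"
  shows "cochain \<Phi>"
proof -
  have "sesquilinear (\<lambda>x. \<Phi> (ws @ x # zs))" for ws zs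
  proof -
    have "\<Phi> (ws @ x # zs) = alternate (length ws) (\<Phi> (x # ws @ zs))" for x
      using skew_move[OF assms(1), of "[]" x ws zs] by simp
    then show ?thesis
      using sesquilinear_alternate[OF assms(2)] by simp
  qed
  with assms(1) show ?thesis by (simp add: cochain_def)
qed

lemma cochain_add:
  assumes "cochain \<Phi>" "cochain \<Psi>"
  shows "cochain (\<lambda>xs. \<Phi> xs + \<Psi> xs)"
proof (rule cochainI)
  show "skew (\<lambda>xs. \<Phi> xs + \<Psi> xs)"
    unfolding skew_def
  proof (intro allI)
    fix ws zs and x y :: "'e \<times> 'k"
    show "\<Phi> (ws @ x # y # zs) + \<Psi> (ws @ x # y # zs) = - (\<Phi> (ws @ y # x # zs) + \<Psi> (ws @ y # x # zs))"
      using skewD[OF cochainD(1)[OF assms(1)], of ws x y zs] skewD[OF cochainD(1)[OF assms(2)], of ws x y zs]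
      by simp
  qed
qed (intro sesquilinear_add cochainD assms)

lemma cochain_scalar:
  assumes "cochain \<Phi>"
  shows "cochain (\<lambda>xs. M.scalar c (\<Phi> xs))"
proof (rule cochainI)
  show "skew (\<lambda>xs. M.scalar c (\<Phi> xs))"
    unfolding skew_def
  proof (intro allI)
    fix ws zs and x y :: "'e \<times> 'k"
    show "M.scalar c (\<Phi> (ws @ x # y # zs)) = - M.scalar c (\<Phi> (ws @ y # x # zs))"
      using skewD[OF cochainD(1)[OF assms], of ws x y zs] by simp
  qed
qed (intro sesquilinear_scalar cochainD assms)

lemma cochain_jacobi: "cochain \<Phi> \<Longrightarrow> leibniz.jacobi \<Phi>"
proof -
  assume \<Phi>: "cochain \<Phi>"
  show ?thesis
    unfolding leibniz.jacobi_def
  proof (intro allI)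
    fix ws x y z zs
    have "fst (bracket x (bracket y z)) = fst (bracket y (bracket x z)) + fst (bracket (bracket x y) z)"
      using bracket_at_jacobi[of "fst x" "snd x" "fst y" "snd y" "fst z"] by (simp add: bracket_def algebra_simps)
    \<comment> \<open>The three pairs have the same second component, so Jacobi becomes an identity
      of first components to which additivity in one slot applies.\<close>
    then have "bracket x (bracket y z) = (fst (bracket y (bracket x z)) + fst (bracket (bracket x y) z), snd x + snd y + snd z)"
      "bracket y (bracket x z) = (fst (bracket y (bracket x z)), snd x + snd y + snd z)"
      "bracket (bracket x y) z = (fst (bracket (bracket x y) z), snd x + snd y + snd z)"
      by (simp_all add: prod_eq_iff) (simp_all add: bracket_def)
    then show "\<Phi> (ws @ bracket x (bracket y z) # zs) =
        \<Phi> (ws @ bracket y (bracket x z) # zs) + \<Phi> (ws @ bracket (bracket x y) z # zs)"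
      using sesquilinearD(2)[OF cochainD(2)[OF \<Phi>]] by metis
  qed
qed

text \<open>The bracket is skew-symmetric only modulo the operators \<open>\<partial> + l\<close>, which cochains annihilate.\<close>

lemma sesquilinear_bracket:
  assumes "sesquilinear f"
  shows "f (bracket x y) = - f (bracket y x)"
proof -
  obtain u l v m where xy: "x = (u, l)" "y = (v, m)" by fastforce
  let ?B = "\<lambda>t. bracket_at v (- l - t) u"
  have pf: "poly_fun E.scalar ?B"
    using E.V.poly_fun_affine[OF poly_fun_bracket_at, where a = "- l" and b = "- 1"] by simp
  have D: "additive_terms (\<lambda>n. E.deriv ^^ n)"
    by (simp add: additive_terms_def linearD[OF funpow_linear[OF E.linear_deriv]])
  have "f (bracket_at u l v, l + m) = - f (subst_power E.scalar (\<lambda>n. E.deriv ^^ n) ?B, l + m)"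
    unfolding bracket_at_skew[of u l v]
    by (rule additive_uminus[of "\<lambda>w. f (w, l + m)"]) (rule sesquilinearD[OF assms])
  also have "f (subst_power E.scalar (\<lambda>n. E.deriv ^^ n) ?B, l + m)
    = subst_power E.scalar (\<lambda>n w. f ((E.deriv ^^ n) w, l + m)) ?B"
    by (rule E.V.subst_power_compose[OF D, of "\<lambda>w. f (w, l + m)"]) (rule sesquilinearD[OF assms])
  also have "\<dots> = subst_power E.scalar (\<lambda>n w. M.scalar ((- (l + m)) ^ n) (f (w, l + m))) ?B"
    by (simp only: sesquilinear_deriv_funpow[OF assms])
  \<comment> \<open>Under \<open>f\<close> the derivation is the scalar \<open>- (l + m)\<close>; at
    this value of \<open>t\<close>, \<open>- l - t\<close> equals \<open>m\<close>, and the bracket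
    with its arguments exchanged remains.\<close>
  also have "\<dots> = f (?B (- (l + m)), l + m)"
    by (rule E.V.subst_power_eval[OF sesquilinearD(1)[OF assms] pf])
  finally show ?thesis
    by (simp add: xy bracket_def add.commute)
qed

lemma cochain_bracket_skew: "cochain \<Phi> \<Longrightarrow> leibniz.bracket_skew \<Phi>"
  unfolding leibniz.bracket_skew_def using sesquilinear_bracket[OF cochainD(2)] by blast

lemma cochain_chevalley_eilenberg:
  assumes "cochain \<Phi>"
  shows "cochain (leibniz.chevalley_eilenberg \<Phi>)"
proof (rule cochainI)
  have "leibniz.chevalley_eilenberg \<Phi> = leibniz.differential \<Phi>"
    using leibniz.chevalley_eilenberg_eq[OF cochainD(1)[OF assms]] by (simp add: fun_eq_iff)
  then show "skew (leibniz.chevalley_eilenberg \<Phi>)"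
    using leibniz.skew_differential[OF cochainD(1)[OF assms] cochain_bracket_skew[OF assms]] by simp
  fix ys
  have *: "\<Phi> (bracket x y # zs) = - \<Phi> (bracket y x # zs)" for x y zs
    by (rule sesquilinear_bracket[OF cochainD(3)[OF assms]])
  \<comment> \<open>Exchanging the entries of the bracket turns the sum into the difference of
    \<open>sesquilinear_action_diff_bracket\<close>.\<close>
  have slot: "sesquilinear (\<lambda>x. action y (\<Phi> (x # zs)) + \<Phi> (bracket x y # zs))" for y zs
    using sesquilinear_action_diff_bracket[OF cochainD(3)[OF assms]] by (simp add: *[of _ y])
  show "sesquilinear (\<lambda>x. leibniz.chevalley_eilenberg \<Phi> (x # ys))"
    unfolding leibniz.chevalley_eilenberg_Cons
    by (rule sesquilinear_add, rule sesquilinear_diff, rule sesquilinear_action,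
        (rule sesquilinear_sum, rule sesquilinear_alternate, rule slot),
        (rule sesquilinear_sum)+, rule sesquilinear_alternate, rule cochainD(4)[OF assms])
qed

lemma chevalley_eilenberg_twice:
  assumes "cochain \<Phi>"
  shows "leibniz.chevalley_eilenberg (leibniz.chevalley_eilenberg \<Phi>) xs = 0"
proof -
  have "leibniz.chevalley_eilenberg \<Phi> = leibniz.differential \<Phi>"
    using leibniz.chevalley_eilenberg_eq[OF cochainD(1)[OF assms]] by (simp add: fun_eq_iff)
  then show ?thesis
    using leibniz.chevalley_eilenberg_eq[OF cochainD(1)[OF cochain_chevalley_eilenberg[OF assms]]]
      leibniz.differential_differential[OF cochain_jacobi[OF assms]] by simp
qed

end


section \<open>Basic cochains and their values\<close>

lemma (in char_0_space) vector_space_coeff_scale: "vector_space (coeff_scale s)"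
  by unfold_locales
    (rule evaluate_eqI, simp add: evaluate_coeff_scale evaluate_add scale_right_distrib scale_left_distrib)+

lemma point_upd: "(point (k # ls))(Lam 0 := l) = point (l # ls)"
  by (auto simp: fun_eq_iff point_def nth_Cons split: var.split nat.split)

lemma length_nths_Compl:
  assumes "S \<subseteq> {..<length xs}"
  shows "length (nths xs (- S)) = length xs - card S"
proof -
  have "{i. i < length xs \<and> i \<in> - S} = {..<length xs} - S"
    by auto
  then show ?thesis
    using assms by (simp add: length_nths card_Diff_subset finite_subset)
qed

context lie_conformal_algebroid_module
begin

abbreviation cochain_space :: "nat \<Rightarrow> ('e list \<Rightarrow> 'm mpol) set"
  where "cochain_space \<equiv> basic_cochains sA der actE actM"

definition pointwise :: "('e list \<Rightarrow> 'm mpol) \<Rightarrow> ('e \<times> 'k) list \<Rightarrow> 'm"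
  where "pointwise \<phi> xs = evaluate M.scalar (point (map snd xs)) (\<phi> (map fst xs))"

lemma basic_cochainsD:
  assumes "\<phi> \<in> cochain_space k"
  shows "length us \<noteq> k \<Longrightarrow> \<phi> us = 0"
    and "\<phi> us \<in> lam_polys (length us)"
    and "i < k \<Longrightarrow> length us = k \<Longrightarrow>
      Vector_Spaces.linear E.scalar (coeff_scale M.scalar) (\<lambda>u. \<phi> (us[i := u]))"
    and "length Ps = k \<Longrightarrow> length us = k \<Longrightarrow> \<phi> (map2 actE Ps us) =
      foldr (\<lambda>i. adjoint_apply der M.mult_by i (Ps ! i)) [0..<k]
        (at_poly M.scalar (map (\<lambda>i. \<Lambda> i + \<xi> i) [0..<k]) (\<phi> us))"
    and "\<pi> permutes {..<k} \<Longrightarrow> length us = k \<Longrightarrow> \<phi> us = coeff_scale M.scalar (of_int (sign \<pi>))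
      (at_poly M.scalar (map (\<lambda>i. \<Lambda> (\<pi> i)) [0..<k]) (\<phi> (permute_list \<pi> us)))"
proof -
  note * = assms[unfolded basic_cochains_def mem_Collect_eq]
  from conjunct1[OF *] show zero: "length us \<noteq> k \<Longrightarrow> \<phi> us = 0"
    by blast
  from conjunct1[OF conjunct2[OF *]] show "\<phi> us \<in> lam_polys (length us)"
    by (cases "length us = k") (simp_all add: zero)
  from conjunct1[OF conjunct2[OF conjunct2[OF *]]] show "i < k \<Longrightarrow> length us = k \<Longrightarrow>
      Vector_Spaces.linear E.scalar (coeff_scale M.scalar) (\<lambda>u. \<phi> (us[i := u]))"
    by blast
  from conjunct1[OF conjunct2[OF conjunct2[OF conjunct2[OF *]]]]
  show "length Ps = k \<Longrightarrow> length us = k \<Longrightarrow> \<phi> (map2 actE Ps us) =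
      foldr (\<lambda>i. adjoint_apply der M.mult_by i (Ps ! i)) [0..<k]
        (at_poly M.scalar (map (\<lambda>i. \<Lambda> i + \<xi> i) [0..<k]) (\<phi> us))"
    by blast
  from conjunct2[OF conjunct2[OF conjunct2[OF conjunct2[OF *]]]]
  show "\<pi> permutes {..<k} \<Longrightarrow> length us = k \<Longrightarrow> \<phi> us = coeff_scale M.scalar (of_int (sign \<pi>))
      (at_poly M.scalar (map (\<lambda>i. \<Lambda> (\<pi> i)) [0..<k]) (\<phi> (permute_list \<pi> us)))"
    by blast
qed

lemma evaluate_eq_pointwise:
  assumes "\<phi> us \<in> lam_polys (length us)"
  shows "evaluate M.scalar \<rho> (\<phi> us) = pointwise \<phi> (zip us (map (\<lambda>i. \<rho> (Lam i)) [0..<length us]))"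
  by (simp add: pointwise_def M.V.evaluate_point[OF assms])

text \<open>The identity operator sets its \<open>X i\<close> to 0, which removes the shift of
  lambda in that slot.\<close>

lemma evaluate_foldr_adjoint_one:
  "(\<And>i. i \<in> set is \<Longrightarrow> Ps ! i = 1) \<Longrightarrow>
    evaluate M.scalar \<rho> (foldr (\<lambda>i. adjoint_apply der M.mult_by i (Ps ! i)) is F)
      = evaluate M.scalar (\<lambda>v. if v \<in> X ` set is then 0 else \<rho> v) F"
proof (induction "is" arbitrary: \<rho>)
  case (Cons i "is")
  have "(\<lambda>v. if v \<in> X ` set is then 0 else (\<rho>(X i := 0)) v) = (\<lambda>v. if v \<in> X ` set (i # is) then 0 else \<rho> v)"
    by (auto simp: fun_eq_iff)
  then show ?case
    using Cons.prems Cons.IH[of "\<rho>(X i := 0)"]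
    by (simp add: M.evaluate_adjoint_apply M.adjoint_one[OF M.V.poly_fun_evaluate] del: fun_upd_apply)
qed simp

text \<open>The axiom acts on all slots at once; taking the identity in every other slot isolates
  the first.\<close>

lemma pointwise_act_first:
  assumes \<phi>: "\<phi> \<in> cochain_space (Suc k)" and len: "length zs = k"
  shows "pointwise \<phi> ((actE P u, l) # zs) = M.adjoint P l (\<lambda>t. pointwise \<phi> ((u, l + t) # zs))"
proof -
  define us Ps \<rho> where "us = u # map fst zs" and "Ps = P # replicate k 1" and "\<rho> = point (l # map snd zs)"
  define F where "F = at_poly M.scalar (map (\<lambda>i. \<Lambda> i + \<xi> i) [0..<Suc k]) (\<phi> us)"
  have "map2 actE (replicate (length vs) 1) vs = vs" for vs
    by (induction vs) (simp_all add: E.act_one)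
  from this[of "map fst zs"] have "pointwise \<phi> ((actE P u, l) # zs) = evaluate M.scalar \<rho> (\<phi> (map2 actE Ps us))"
    using len by (simp add: pointwise_def \<rho>_def us_def Ps_def)
  also have "\<phi> (map2 actE Ps us) = foldr (\<lambda>i. adjoint_apply der M.mult_by i (Ps ! i)) (0 # [1..<Suc k]) F"
    using basic_cochainsD(4)[OF \<phi>, of Ps us] len
    by (simp add: us_def Ps_def F_def upt_conv_Cons del: upt_Suc)
  also have "evaluate M.scalar \<rho> \<dots> = M.adjoint P l (\<lambda>t. evaluate M.scalar (\<rho>(X 0 := t))
      (foldr (\<lambda>i. adjoint_apply der M.mult_by i (Ps ! i)) [1..<Suc k] F))"
    by (simp add: M.evaluate_adjoint_apply Ps_def \<rho>_def point_def del: fun_upd_apply upt_Suc)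
  also have "\<dots> = M.adjoint P l (\<lambda>t. pointwise \<phi> ((u, l + t) # zs))"
  proof (rule arg_cong[where f = "M.adjoint P l"], rule ext)
    fix t
    let ?\<rho> = "\<lambda>v. if v \<in> X ` set [1..<Suc k] then 0 else (\<rho>(X 0 := t)) v"
    have "evaluate M.scalar (\<rho>(X 0 := t)) (foldr (\<lambda>i. adjoint_apply der M.mult_by i (Ps ! i)) [1..<Suc k] F)
      = evaluate M.scalar ?\<rho> F"
      by (rule evaluate_foldr_adjoint_one) (auto simp: Ps_def nth_Cons')
    also have "\<dots> = evaluate M.scalar (point (map (scalar_value ?\<rho>) (map (\<lambda>i. \<Lambda> i + \<xi> i) [0..<Suc k]))) (\<phi> us)"
      unfolding F_def using basic_cochainsD(2)[OF \<phi>, of us] len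
      by (subst M.V.evaluate_at_poly) (simp_all add: us_def)
    also have "map (scalar_value ?\<rho>) (map (\<lambda>i. \<Lambda> i + \<xi> i) [0..<Suc k]) = (l + t) # map snd zs"
    proof (rule nth_equalityI)
      fix i assume "i < length (map (scalar_value ?\<rho>) (map (\<lambda>i. \<Lambda> i + \<xi> i) [0..<Suc k]))"
      then have "i < Suc k" by simp
      then show "map (scalar_value ?\<rho>) (map (\<lambda>i. \<Lambda> i + \<xi> i) [0..<Suc k]) ! i = ((l + t) # map snd zs) ! i"
        using len by (cases i) (auto simp: scalar_value_simps \<rho>_def point_def simp del: upt_Suc)
    qed (use len in simp)
    finally show "evaluate M.scalar (\<rho>(X 0 := t)) (foldr (\<lambda>i. adjoint_apply der M.mult_by i (Ps ! i)) [1..<Suc k] F)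
        = pointwise \<phi> ((u, l + t) # zs)"
      by (simp only: pointwise_def us_def list.map fst_conv snd_conv)
  qed
  finally show ?thesis .
qed

lemma evaluate_at_permuted:
  assumes "F \<in> lam_polys n"
  shows "evaluate M.scalar \<rho> (at_poly M.scalar (map (\<lambda>i. \<Lambda> (\<pi> i)) [0..<n]) F)
    = evaluate M.scalar (point (map (\<lambda>i. \<rho> (Lam (\<pi> i))) [0..<n])) F"
  using assms by (subst M.V.evaluate_at_poly) (simp_all add: comp_def)

lemma pointwise_permute:
  assumes "\<phi> \<in> cochain_space k" "length xs = k" "\<pi> permutes {..<k}"
  shows "pointwise \<phi> xs = M.scalar (of_int (sign \<pi>)) (pointwise \<phi> (permute_list \<pi> xs))"
proof -
  have "map (\<lambda>i. point (map snd xs) (Lam (\<pi> i))) [0..<k] = map snd (permute_list \<pi> xs)"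
    using assms(2) permutes_in_image[OF assms(3)] by (auto simp: permute_list_def point_def)
  moreover have "map fst (permute_list \<pi> xs) = permute_list \<pi> (map fst xs)"
    using assms(2,3) by (simp add: permute_list_map)
  moreover have "\<phi> (permute_list \<pi> (map fst xs)) \<in> lam_polys k"
    using basic_cochainsD(2)[OF assms(1), of "permute_list \<pi> (map fst xs)"] assms(2) by simp
  ultimately show ?thesis
    using arg_cong[OF basic_cochainsD(5)[OF assms(1,3), of "map fst xs"], of "evaluate M.scalar (point (map snd xs))"] assms(2)
    by (simp add: pointwise_def M.V.evaluate_coeff_scale evaluate_at_permuted)
qed

lemma cochain_pointwise:
  assumes \<phi>: "\<phi> \<in> cochain_space k"
  shows "cochain (pointwise \<phi>)"
proof (rule cochainI)
  have zero: "pointwise \<phi> xs = 0" if "length xs \<noteq> k" for xs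
    using basic_cochainsD(1)[OF \<phi>, of "map fst xs"] that by (simp add: pointwise_def)
  show "skew (pointwise \<phi>)"
    unfolding skew_def
  proof (intro allI)
    fix ws x y zs
    show "pointwise \<phi> (ws @ x # y # zs) = - pointwise \<phi> (ws @ y # x # zs)"
    proof (cases "length (ws @ x # y # zs) = k")
      case True
      let ?t = "Transposition.transpose (length ws) (length ws + Suc 0)"
      have "?t permutes {..<k}"
        using True by (intro permutes_swap_id) auto
      then show ?thesis
        using pointwise_permute[OF \<phi> True, of ?t] permute_list_transpose[of ws "[]" x y zs]
        by (simp add: sign_swap_id)
    next
      case False
      then show ?thesis using zero by simp
    qed
  qed
  fix zs
  show "sesquilinear (\<lambda>x. pointwise \<phi> (x # zs))"
  proof (cases "k = Suc (length zs)")
    case True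
    show ?thesis
    proof (rule sesquilinear_ofI)
      fix l
      show "Vector_Spaces.linear E.scalar M.scalar (\<lambda>u. pointwise \<phi> ((u, l) # zs))"
        using basic_cochainsD(3)[OF \<phi>, of 0 "0 # map fst zs"] True
        by (simp add: Vector_Spaces.linear_iff M.vector_space_scalar pointwise_def M.V.evaluate_add
            M.V.evaluate_coeff_scale)
    next
      fix u
      show "poly_fun M.scalar (\<lambda>l. pointwise \<phi> ((u, l) # zs))"
        using M.V.poly_fun_evaluate[of "point (0 # map snd zs)" "Lam 0" "\<phi> (u # map fst zs)"]
        by (simp only: point_upd pointwise_def list.map fst_conv snd_conv)
    next
      fix P u l
      show "pointwise \<phi> ((actE P u, l) # zs) = M.adjoint P l (\<lambda>t. pointwise \<phi> ((u, l + t) # zs))"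
        using pointwise_act_first \<phi> True by blast
    qed
  next
    case False
    then show ?thesis using zero by (simp add: sesquilinear_zero)
  qed
qed

text \<open>Induction runs downward in \<open>j\<close>: slots from \<open>j\<close> on carry their
  operators, slots below \<open>j\<close> still hold the shift by \<open>X i\<close> of factors not
  yet applied. At \<open>n\<close> this is the bare substitution, at 0 the sesquilinearity
  axiom.\<close>

lemma evaluate_foldr_adjoint:
  assumes \<phi>: "cochain (pointwise \<phi>)" "\<phi> us \<in> lam_polys n" and len: "length us = n"
  shows "j \<le> n \<Longrightarrow> evaluate M.scalar \<rho> (foldr (\<lambda>i. adjoint_apply der M.mult_by i (Ps ! i)) [j..<n]
      (at_poly M.scalar (map (\<lambda>i. \<Lambda> i + \<xi> i) [0..<n]) (\<phi> us)))
    = pointwise \<phi> (map (\<lambda>i. if i < j then (us ! i, \<rho> (Lam i) + \<rho> (X i))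
        else (actE (Ps ! i) (us ! i), \<rho> (Lam i))) [0..<n])"
proof (induction arbitrary: \<rho> rule: inc_induct)
  case base
  have "map fst (map (\<lambda>i. if i < n then (us ! i, \<rho> (Lam i) + \<rho> (X i))
      else (actE (Ps ! i) (us ! i), \<rho> (Lam i))) [0..<n]) = us"
    using len by (intro nth_equalityI) auto
  moreover have "map snd (map (\<lambda>i. if i < n then (us ! i, \<rho> (Lam i) + \<rho> (X i))
      else (actE (Ps ! i) (us ! i), \<rho> (Lam i))) [0..<n]) = map (\<lambda>i. \<rho> (Lam i) + \<rho> (X i)) [0..<n]"
    by auto
  moreover have "evaluate M.scalar \<rho> (at_poly M.scalar (map (\<lambda>i. \<Lambda> i + \<xi> i) [0..<n]) (\<phi> us))
      = evaluate M.scalar (point (map (\<lambda>i. \<rho> (Lam i) + \<rho> (X i)) [0..<n])) (\<phi> us)"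
    using \<phi>(2) by (subst M.V.evaluate_at_poly) (simp_all add: comp_def scalar_value_simps)
  ultimately show ?case
    by (simp only: pointwise_def upt_conv_Nil[OF order_refl] foldr.simps id_apply)
next
  case (step j)
  let ?f = "\<lambda>\<rho> j i. if i < j then (us ! i, \<rho> (Lam i) + \<rho> (X i)) else (actE (Ps ! i) (us ! i), \<rho> (Lam i))"
  have upt_split: "map g [0..<n] = map g [0..<j] @ g j # map g [Suc j..<n]" for g :: "nat \<Rightarrow> 'e \<times> 'k"
    using step(2) upt_add_eq_append[of 0 j "n - j"] by (simp add: upt_conv_Cons)
  have eq: "map (?f (\<rho>(X j := t)) (Suc j)) [0..<n]
      = map (?f \<rho> j) [0..<j] @ (us ! j, \<rho> (Lam j) + t) # map (?f \<rho> j) [Suc j..<n]" for t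
    unfolding upt_split by auto
  let ?F = "at_poly M.scalar (map (\<lambda>i. \<Lambda> i + \<xi> i) [0..<n]) (\<phi> us)"
  have "evaluate M.scalar \<rho> (foldr (\<lambda>i. adjoint_apply der M.mult_by i (Ps ! i)) [j..<n] ?F)
    = M.adjoint (Ps ! j) (\<rho> (Lam j)) (\<lambda>t. evaluate M.scalar (\<rho>(X j := t))
        (foldr (\<lambda>i. adjoint_apply der M.mult_by i (Ps ! i)) [Suc j..<n] ?F))"
    using step(2) by (simp add: upt_conv_Cons M.evaluate_adjoint_apply del: fun_upd_apply)
  also have "\<dots> = M.adjoint (Ps ! j) (\<rho> (Lam j)) (\<lambda>t. pointwise \<phi>
      (map (?f \<rho> j) [0..<j] @ (us ! j, \<rho> (Lam j) + t) # map (?f \<rho> j) [Suc j..<n]))"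
    by (simp only: step.IH eq)
  also have "\<dots> = pointwise \<phi> (map (?f \<rho> j) [0..<j] @ (actE (Ps ! j) (us ! j), \<rho> (Lam j))
      # map (?f \<rho> j) [Suc j..<n])"
    by (rule sesquilinear_act[OF cochainD(2)[OF \<phi>(1)], symmetric])
  also have "map (?f \<rho> j) [0..<j] @ (actE (Ps ! j) (us ! j), \<rho> (Lam j)) # map (?f \<rho> j) [Suc j..<n]
    = map (?f \<rho> j) [0..<n]"
    unfolding upt_split by simp
  finally show ?case .
qed

text \<open>Linearity, sesquilinearity and skew-symmetry are identities of polynomials, so they
  follow from their values, where \<open>cochain\<close> supplies them slot by slot. Together with
  \<open>cochain_pointwise\<close> this is the dictionary in both directions.\<close>

lemma basic_cochainsI:
  assumes zero: "\<And>us. length us \<noteq> n \<Longrightarrow> \<phi> us = 0"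
    and poly: "\<And>us. length us = n \<Longrightarrow> \<phi> us \<in> lam_polys n"
    and \<phi>: "cochain (pointwise \<phi>)"
  shows "\<phi> \<in> cochain_space n"
  unfolding basic_cochains_def
proof (intro CollectI conjI allI impI)
  have eval: "evaluate M.scalar \<rho> (\<phi> us) = pointwise \<phi> (zip us (map (\<lambda>i. \<rho> (Lam i)) [0..<n]))"
    if "length us = n" for us and \<rho> :: "var \<Rightarrow> 'k"
    using evaluate_eq_pointwise[of \<phi> us \<rho>] poly that by simp
  show "Vector_Spaces.linear E.scalar (coeff_scale M.scalar) (\<lambda>u. \<phi> (us[i := u]))"
    if "i < n" "length us = n" for us i
  proof -
    have "evaluate M.scalar \<rho> (\<phi> (us[i := u])) = pointwise \<phi> (take i (zip us (map (\<lambda>i. \<rho> (Lam i)) [0..<n]))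
        @ (u, \<rho> (Lam i)) # drop (Suc i) (zip us (map (\<lambda>i. \<rho> (Lam i)) [0..<n])))" for u and \<rho> :: "var \<Rightarrow> 'k"
    proof -
      have "zip (us[i := u]) (map (\<lambda>i. \<rho> (Lam i)) [0..<n])
        = (zip us (map (\<lambda>i. \<rho> (Lam i)) [0..<n]))[i := (u, \<rho> (Lam i))]"
        using that by (intro nth_equalityI) (auto simp: nth_list_update)
      then show ?thesis
        using that by (simp add: eval upd_conv_take_nth_drop)
    qed
    note ev = this
    show ?thesis
      unfolding Vector_Spaces.linear_iff
      by (intro conjI allI E.vector_space_scalar M.V.vector_space_coeff_scale M.V.evaluate_eqI)
         (simp_all only: M.V.evaluate_add M.V.evaluate_coeff_scale ev sesquilinearD[OF cochainD(2)[OF \<phi>]])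
  qed
  show "\<phi> (map2 actE Ps us) = foldr (\<lambda>i. adjoint_apply der M.mult_by i (Ps ! i)) [0..<n]
        (at_poly M.scalar (map (\<lambda>i. \<Lambda> i + \<xi> i) [0..<n]) (\<phi> us))"
    if "length Ps = n" "length us = n" for Ps us
  proof (rule M.V.evaluate_eqI)
    fix \<rho> :: "var \<Rightarrow> 'k"
    have "zip (map2 actE Ps us) (map (\<lambda>i. \<rho> (Lam i)) [0..<n])
      = map (\<lambda>i. (actE (Ps ! i) (us ! i), \<rho> (Lam i))) [0..<n]"
      using that by (intro nth_equalityI) auto
    then show "evaluate M.scalar \<rho> (\<phi> (map2 actE Ps us)) = evaluate M.scalar \<rho>
      (foldr (\<lambda>i. adjoint_apply der M.mult_by i (Ps ! i)) [0..<n]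
        (at_poly M.scalar (map (\<lambda>i. \<Lambda> i + \<xi> i) [0..<n]) (\<phi> us)))"
      using evaluate_foldr_adjoint[OF \<phi> poly[OF that(2)] that(2), of 0 \<rho> Ps] that
      by (simp add: eval)
  qed
  show "\<phi> us = coeff_scale M.scalar (of_int (sign \<pi>))
      (at_poly M.scalar (map (\<lambda>i. \<Lambda> (\<pi> i)) [0..<n]) (\<phi> (permute_list \<pi> us)))"
    if "\<pi> permutes {..<n}" "length us = n" for \<pi> us
  proof (rule M.V.evaluate_eqI)
    fix \<rho> :: "var \<Rightarrow> 'k"
    let ?xs = "zip us (map (\<lambda>i. \<rho> (Lam i)) [0..<n])"
    have len: "length ?xs = n"
      using that by simp
    have "\<phi> (permute_list \<pi> us) \<in> lam_polys n"
      using poly that by simp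
    moreover have "map fst (permute_list \<pi> ?xs) = permute_list \<pi> us"
      using that len by (simp flip: permute_list_map)
    moreover have "map snd (permute_list \<pi> ?xs) = map (\<lambda>i. \<rho> (Lam (\<pi> i))) [0..<n]"
      using that len permutes_in_image[OF that(1)] by (auto simp: permute_list_def)
    ultimately have "evaluate M.scalar \<rho> (at_poly M.scalar (map (\<lambda>i. \<Lambda> (\<pi> i)) [0..<n]) (\<phi> (permute_list \<pi> us)))
      = pointwise \<phi> (permute_list \<pi> ?xs)"
      by (simp add: pointwise_def evaluate_at_permuted)
    then show "evaluate M.scalar \<rho> (\<phi> us) = evaluate M.scalar \<rho> (coeff_scale M.scalar (of_int (sign \<pi>))
      (at_poly M.scalar (map (\<lambda>i. \<Lambda> (\<pi> i)) [0..<n]) (\<phi> (permute_list \<pi> us))))"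
      using skew_permute[OF cochainD(1)[OF \<phi>], of \<pi> ?xs] len that
      by (auto simp: eval M.V.evaluate_coeff_scale sign_def split: if_splits)
  qed
qed (use zero poly in auto)

end


section \<open>The basic differential\<close>

context lie_conformal_algebroid_module
begin

abbreviation diff :: "nat \<Rightarrow> ('e list \<Rightarrow> 'm mpol) \<Rightarrow> 'e list \<Rightarrow> 'm mpol"
  where "diff \<equiv> basic_differential sA actE br actM lact"

lemma scalar_alternate: "M.scalar ((- 1) ^ n) m = alternate n m"
  by (simp add: alternate_def)

lemma evaluate_diff:
  assumes \<phi>: "\<phi> \<in> cochain_space k" and len: "length us = Suc k"
  shows "evaluate M.scalar \<rho> (diff k \<phi> us)
    = leibniz.chevalley_eilenberg (pointwise \<phi>) (zip us (map (\<lambda>i. \<rho> (Lam i)) [0..<Suc k]))"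
proof -
  define ls :: "'k mpol list" where "ls = map \<Lambda> [0..<Suc k]"
  define xs where "xs = zip us (map (\<lambda>i. \<rho> (Lam i)) [0..<Suc k])"
  have xs: "length xs = Suc k" "map fst xs = us" "map snd xs = map (scalar_value \<rho>) ls"
    using len by (simp_all add: xs_def ls_def comp_def del: upt_Suc)
  have nth: "xs ! i = (us ! i, \<rho> (Lam i))" if "i < Suc k" for i
    using that len by (simp add: xs_def del: upt_Suc)
  have nths: "map fst (nths xs A) = nths us A" "map snd (nths xs A) = map (scalar_value \<rho>) (nths ls A)" for A
    using xs(2,3) by (simp_all add: nths_map[symmetric])
  have len_nths: "length (nths us A) = length (nths ls A)" for A
    using nths[of A] by (metis length_map)
  have 1: "evaluate M.scalar \<rho> (lin_ext (\<lambda>m. at_poly M.scalar [\<Lambda> i] (lact (us ! i) m))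
      (at_poly M.scalar (nths ls A) (\<phi> (nths us A)))) = action (xs ! i) (pointwise \<phi> (nths xs A))"
    if "i < Suc k" for i A
  proof -
    have "evaluate M.scalar \<rho> (at_poly M.scalar (nths ls A) (\<phi> (nths us A))) = pointwise \<phi> (nths xs A)"
      using basic_cochainsD(2)[OF \<phi>, of "nths us A"]
      by (subst M.V.evaluate_at_poly) (simp_all add: len_nths pointwise_def nths)
    then show ?thesis
      using that by (simp add: M.V.evaluate_lin_ext evaluate_lact_at action_at_linear_right action_def nth)
  qed
  have 2: "evaluate M.scalar \<rho> (lin_ext
        (\<lambda>z. at_poly M.scalar ((\<Lambda> i + \<Lambda> j) # nths ls A) (\<phi> (z # nths us A)))
        (at_poly E.scalar [\<Lambda> i] (br (us ! i) (us ! j))))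
      = pointwise \<phi> (bracket (xs ! i) (xs ! j) # nths xs A)" if "i < Suc k" "j < Suc k" for i j A
  proof -
    have ev: "evaluate M.scalar \<rho> (at_poly M.scalar ((\<Lambda> i + \<Lambda> j) # nths ls A) (\<phi> (z # nths us A)))
      = pointwise \<phi> ((z, \<rho> (Lam i) + \<rho> (Lam j)) # nths xs A)" for z
      using basic_cochainsD(2)[OF \<phi>, of "z # nths us A"]
      by (subst M.V.evaluate_at_poly) (simp_all add: len_nths pointwise_def nths scalar_value_simps)
    \<comment> \<open>Extending over the coefficients of the bracket requires linearity of the
      cochain in its first argument.\<close>
    have "Vector_Spaces.linear E.scalar M.scalar (\<lambda>z. evaluate M.scalar \<rho>
        (at_poly M.scalar ((\<Lambda> i + \<Lambda> j) # nths ls A) (\<phi> (z # nths us A))))"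
      unfolding ev by (rule sesquilinearD(1)[OF cochainD(3)[OF cochain_pointwise[OF \<phi>]]])
    from E.V.evaluate_lin_ext[OF this] show ?thesis
      using that by (simp add: ev evaluate_br_at bracket_def nth)
  qed
  show ?thesis
    unfolding xs_def[symmetric] leibniz.chevalley_eilenberg_def basic_differential_def Let_def ls_def[symmetric]
    by (simp add: len xs(1) M.V.evaluate_add M.V.evaluate_sum M.V.evaluate_coeff_scale scalar_alternate 1 2
        del: sum.lessThan_Suc cong: sum.cong_simp)
qed

lemma diff_zero: "length us \<noteq> Suc k \<Longrightarrow> diff k \<phi> us = 0"
  by (simp add: basic_differential_def)

lemma diff_lam_polys:
  assumes "length us = Suc k"
  shows "diff k \<phi> us \<in> lam_polys (Suc k)"
proof -
  have "q \<in> lam_polys (Suc k)" if "q \<in> set (nths (map \<Lambda> [0..<Suc k]) A)" for q :: "'k mpol" and A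
    using in_set_nthsD[OF that] by (auto simp: lam_polys_Lam simp del: upt_Suc)
  then show ?thesis
    unfolding basic_differential_def Let_def using assms
    by (auto intro!: lam_polys_add lam_polys_sum lam_polys_lin_ext lam_polys_at_poly lam_polys_Lam
        lam_polys_coeff_scale simp del: upt_Suc sum.lessThan_Suc)
qed

text \<open>Iterating the differential requires equality on lists of every length. Off length
  \<open>Suc k\<close> the left side is 0 by convention, the right side because each of its terms
  evaluates the cochain on a list one shorter than \<open>xs\<close>.\<close>

lemma pointwise_diff:
  assumes \<phi>: "\<phi> \<in> cochain_space k"
  shows "pointwise (diff k \<phi>) = leibniz.chevalley_eilenberg (pointwise \<phi>)"
proof
  fix xs
  show "pointwise (diff k \<phi>) xs = leibniz.chevalley_eilenberg (pointwise \<phi>) xs"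
  proof (cases "length xs = Suc k")
    case True
    have "zip (map fst xs) (map (\<lambda>i. point (map snd xs) (Lam i)) [0..<Suc k]) = xs"
      using True by (intro nth_equalityI) (auto simp: point_def simp del: upt_Suc)
    then show ?thesis
      unfolding pointwise_def[of "diff k \<phi>"] using True evaluate_diff[OF \<phi>, of "map fst xs"] by simp
  next
    case False
    have zero: "pointwise \<phi> ys = 0" if "length ys \<noteq> k" for ys
      using basic_cochainsD(1)[OF \<phi>, of "map fst ys"] that by (simp add: pointwise_def)
    have "pointwise \<phi> (nths xs (- {i})) = 0" if "i < length xs" for i
      using that False by (intro zero) (simp add: length_nths_Compl)
    moreover have "pointwise \<phi> (z # nths xs (- {i, j})) = 0" if "i < j" "j < length xs" for z i j
      using that False by (intro zero) (simp add: length_nths_Compl)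
    ultimately show ?thesis
      unfolding leibniz.chevalley_eilenberg_def
      using False by (simp add: pointwise_def[of "diff k \<phi>"] diff_zero)
  qed
qed

theorem diff_closed:
  assumes \<phi>: "\<phi> \<in> cochain_space k"
  shows "diff k \<phi> \<in> cochain_space (Suc k)"
proof (rule basic_cochainsI)
  show "cochain (pointwise (diff k \<phi>))"
    unfolding pointwise_diff[OF \<phi>] by (rule cochain_chevalley_eilenberg) (rule cochain_pointwise[OF \<phi>])
qed (rule diff_zero, assumption, rule diff_lam_polys)

lemma diff_eqI:
  assumes "\<And>xs. length xs = Suc k \<Longrightarrow> pointwise (diff k \<phi>) xs = pointwise \<psi> xs"
    and "\<And>us. length us = Suc k \<Longrightarrow> \<psi> us \<in> lam_polys (Suc k)" "\<And>us. length us \<noteq> Suc k \<Longrightarrow> \<psi> us = 0"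
  shows "diff k \<phi> = \<psi>"
proof
  fix us
  show "diff k \<phi> us = \<psi> us"
  proof (cases "length us = Suc k")
    case True
    show ?thesis
    proof (rule M.V.evaluate_eqI)
      fix \<rho> :: "var \<Rightarrow> 'k"
      show "evaluate M.scalar \<rho> (diff k \<phi> us) = evaluate M.scalar \<rho> (\<psi> us)"
        using True evaluate_eq_pointwise[of "diff k \<phi>" us \<rho>] evaluate_eq_pointwise[of \<psi> us \<rho>]
          diff_lam_polys[OF True] assms(1,2) by (simp del: upt_Suc)
    qed
  next
    case False
    then show ?thesis using assms(3) by (simp add: diff_zero)
  qed
qed

section \<open>Linearity and square of the differential\<close>

lemma pointwise_add: "pointwise (\<lambda>us. \<phi> us + \<psi> us) = (\<lambda>xs. pointwise \<phi> xs + pointwise \<psi> xs)"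
  by (simp add: fun_eq_iff pointwise_def M.V.evaluate_add)

lemma pointwise_scale:
  "pointwise (\<lambda>us. coeff_scale M.scalar c (\<phi> us)) = (\<lambda>xs. M.scalar c (pointwise \<phi> xs))"
  by (simp add: fun_eq_iff pointwise_def M.V.evaluate_coeff_scale)

lemma basic_cochains_add:
  assumes "\<phi> \<in> cochain_space k" "\<psi> \<in> cochain_space k"
  shows "(\<lambda>us. \<phi> us + \<psi> us) \<in> cochain_space k"
proof (rule basic_cochainsI)
  show "\<phi> us + \<psi> us \<in> lam_polys k" if "length us = k" for us
    using that basic_cochainsD(2)[OF assms(1), of us] basic_cochainsD(2)[OF assms(2), of us]
    by (simp add: lam_polys_add)
qed (simp_all add: basic_cochainsD(1)[OF assms(1)] basic_cochainsD(1)[OF assms(2)] pointwise_add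
    cochain_add cochain_pointwise[OF assms(1)] cochain_pointwise[OF assms(2)])

lemma basic_cochains_scale:
  assumes "\<phi> \<in> cochain_space k"
  shows "(\<lambda>us. coeff_scale M.scalar c (\<phi> us)) \<in> cochain_space k"
proof (rule basic_cochainsI)
  show "coeff_scale M.scalar c (\<phi> us) \<in> lam_polys k" if "length us = k" for us
    using that basic_cochainsD(2)[OF assms, of us] by (simp add: lam_polys_coeff_scale)
qed (simp_all add: basic_cochainsD(1)[OF assms] pointwise_scale cochain_scalar cochain_pointwise[OF assms])

lemma action_scalar: "action x (M.scalar c m) = M.scalar c (action x m)"
  by (simp add: action_def linearD[OF action_at_linear_right])

lemma alternate_scalar: "alternate n (M.scalar c m) = M.scalar c (alternate n m)"
  by (simp add: alternate_def)

lemma diff_add: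
  assumes "\<phi> \<in> cochain_space k" "\<psi> \<in> cochain_space k"
  shows "diff k (\<lambda>us. \<phi> us + \<psi> us) = (\<lambda>us. diff k \<phi> us + diff k \<psi> us)"
  by (rule diff_eqI)
    (simp_all add: pointwise_diff basic_cochains_add assms pointwise_add leibniz.chevalley_eilenberg_def
      leibniz.op_add sum.distrib diff_lam_polys lam_polys_add diff_zero)

lemma diff_scale:
  assumes "\<phi> \<in> cochain_space k"
  shows "diff k (\<lambda>us. coeff_scale M.scalar c (\<phi> us)) = (\<lambda>us. coeff_scale M.scalar c (diff k \<phi> us))"
  by (rule diff_eqI)
    (simp_all add: pointwise_diff basic_cochains_scale assms pointwise_scale leibniz.chevalley_eilenberg_def
      action_scalar alternate_scalar M.V.scale_sum_right M.V.scale_right_distrib diff_lam_polys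
      lam_polys_coeff_scale diff_zero)

theorem diff_diff:
  assumes \<phi>: "\<phi> \<in> cochain_space k"
  shows "diff (Suc k) (diff k \<phi>) = (\<lambda>us. 0)"
  by (rule diff_eqI)
    (simp_all add: pointwise_diff diff_closed \<phi> chevalley_eilenberg_twice cochain_pointwise[OF \<phi>] pointwise_def)

end

theorem proposition3p3:
  fixes sA :: "'k::field_char_0 \<Rightarrow> 'a::comm_ring_1 \<Rightarrow> 'a"
    and der :: "'a \<Rightarrow> 'a"
    and actE :: "'a poly \<Rightarrow> 'e::ab_group_add \<Rightarrow> 'e"
    and br :: "'e \<Rightarrow> 'e \<Rightarrow> 'e mpol"
    and \<theta> :: "'e \<Rightarrow> 'a \<Rightarrow> 'a mpol"
    and actM :: "'a poly \<Rightarrow> 'm::ab_group_add \<Rightarrow> 'm"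
    and lact :: "'e \<Rightarrow> 'm \<Rightarrow> 'm mpol"
    and C :: "nat \<Rightarrow> ('e list \<Rightarrow> 'm mpol) set"
    and d :: "nat \<Rightarrow> ('e list \<Rightarrow> 'm mpol) \<Rightarrow> 'e list \<Rightarrow> 'm mpol"
    and k :: nat
  defines "C \<equiv> basic_cochains sA der actE actM"
    and "d \<equiv> basic_differential sA actE br actM lact"
  assumes "lie_conformal_algebroid sA der actE br \<theta>"
    and "lie_conformal_algebroid_module sA der actE br \<theta> actM lact"
  shows "(\<forall>\<phi> \<in> C k. d k \<phi> \<in> C (Suc k)) \<and>
    (\<forall>\<phi> \<in> C k. \<forall>\<psi> \<in> C k. d k (\<lambda>us. \<phi> us + \<psi> us) = (\<lambda>us. d k \<phi> us + d k \<psi> us)) \<and>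
    (\<forall>c. \<forall>\<phi> \<in> C k.
       d k (\<lambda>us. coeff_scale (scalar_act sA actM) c (\<phi> us)) =
         (\<lambda>us. coeff_scale (scalar_act sA actM) c (d k \<phi> us))) \<and>
    (\<forall>\<phi> \<in> C k. d (Suc k) (d k \<phi>) = (\<lambda>us. 0))"
proof -
  interpret lie_conformal_algebroid_module sA der actE br \<theta> actM lact by fact
  show ?thesis
    unfolding C_def d_def
    by (intro conjI ballI allI diff_closed diff_add diff_scale diff_diff)
qed

end
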